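(* Let $(\mathcal S,\mathcal A,\mathbf c,\mathbf P,\gamma)$ be a Turn-Based Deterministic Forward Game (TBDFG) with $n$ states, $m$ actions and uniform discount factor $\gamma\in(0,1)$. The simple strategy-iteration method (described in the context) converges on this game, i.e. terminates with an optimal strategy profile, in at most $O(n^6m^4\log^4 n)$ pivot steps of the simplex method in total. Therefore, the simple strategy-iteration method is strongly polynomial for TBDFGs.
   Context: TBDG. A turn-based deterministic zero-sum game (TBDG) $(\mathcal S,\mathcal A,\mathbf c,\mathbf P,\gamma)$ has states $\mathcal S=\mathcal S^1\sqcup\mathcal S^2=[n]$ (Player $i$ controls $\mathcal S^i$), actions $\mathcal A=\bigsqcup_{s\in\mathcal S}\mathcal A_s=[m]$ ($\mathcal A_s$ nonempty, the actions playable at $s$), $\mathcal A^i=\bigcup_{s\in\mathcal S^i}\mathcal A_s$, real costs $c_a$, a point-mass transition distribution $\mathbf p_a\in\mathbb R^n$ for each action (so action $a\in\mathcal A_s$ moves deterministically from $s$ to one state), and a discount factor $\gamma\in(0,1)$. Player 1 minimizes and Player 2 maximizes the total discounted cost. The game graph is the directed graph with vertex set $\mathcal S$ and one edge per action $a\in\mathcal A_s$, from $s$ to the state to which $a$ moves. TBDFG. A TBDFG is a TBDG whose game graph contains no directed cycle involving actions of both players (self-loops are allowed directed cycles). Strategies. A strategy of Player $i$ picks one action in $\mathcal A_s$ for each $s\in\mathcal S^i$; a strategy profile is a pair $\pi=(\sigma,\tau)$ of strategies of Players 1 and 2. Its value vector $\mathbf v^\pi\in\mathbb R^n$ is the unique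 solution of $v_s=c_{\pi_s}+\gamma\,\mathbf p_{\pi_s}^T\mathbf v$, $s\in\mathcal S$. The reduced cost of $a\in\mathcal A_s$ is $r^\pi_a=c_a+\gamma\,\mathbf p_a^T\mathbf v^\pi-v^\pi_s$. $\pi^2(\sigma)$ denotes an optimal counter strategy of Player 2 against $\sigma$: $\mathbf v^{(\sigma,\tau')}\le\mathbf v^{(\sigma,\pi^2(\sigma))}$ componentwise for all $\tau'$. Similarly $\pi^1(\tau)$ satisfies $\mathbf v^{(\pi^1(\tau),\tau)}\le\mathbf v^{(\sigma',\tau)}$ for all $\sigma'$. A profile $(\sigma,\tau)$ is optimal if $\sigma$ and $\tau$ are optimal counter strategies against each other. Simple strategy-iteration method. Start from any $\pi_0=(\sigma_0,\tau_0)$ with $\tau_0=\pi^2(\sigma_0)$. For $k=1,2,\dots$: (1) One simplex step for Player 1: let $a'\in\mathcal A^1$ minimize $r^{\pi_{k-1}}_a$ over $a\in\mathcal A^1$ (ties broken arbitrarily). If $r^{\pi_{k-1}}_{a'}<0$, obtain $\sigma_k$ from $\sigma_{k-1}$ by switching to $a'$ at the state $s'$ with $a'\in\mathcal A_{s'}$ (only this state changes); otherwise $\sigma_k=\sigma_{k-1}$. (2) With $\sigma_k$ fixed, start from $\tau_{k-1}$ and run the simplex method with the simple pivoting rule on Player 2's deterministic Markov decision problem (repeatedly switch, at a single state, to the Player 2 action of largest positive reduced cost, until none is positive) to obtain $\tau_k=\pi^2(\sigma_k)$. (3) Put $\pi_k=(\sigma_k,\tau_k)$ and compute $\mathbf v^{\pi_k}$.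 (4) If $\mathbf v^{\pi_k}=\mathbf v^{\pi_{k-1}}$, terminate and return $\pi_k$; otherwise continue with $k+1$. Each single-state switch, of either player, counts as one pivot step. $O(\cdot)$ is the usual asymptotic notation with an absolute constant, independent of the costs, of $\gamma$ and of the game. Strongly polynomial means that the number of arithmetic operations is bounded by a polynomial in $n,m$ that does not depend on the numerical data $\mathbf c,\gamma$. *)

theory Defs
  imports
    Complex_Main
    "HOL-Library.FuncSet"
    "HOL-Library.State_Monad"
    "HOL-Computational_Algebra.Polynomial"
    "Graph_Theory.Arc_Walk"
begin

section \<open>Turn-based deterministic games\<close>

text \<open>
  States are the numbers below \<open>n\<close> and actions the numbers below \<open>m\<close>. An action \<open>a\<close> is
  playable at exactly one state, \<open>loc a\<close>, so the sets of actions playable at the different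
  states automatically partition the set of all actions.
\<close>

record tbdg =
  nstates :: nat
  nactions :: nat
  states1 :: "nat set"
  states2 :: "nat set"
  loc :: "nat \<Rightarrow> nat"
  dest :: "nat \<Rightarrow> nat"
  cost :: "nat \<Rightarrow> real"
  discount :: real

definition acts :: "tbdg \<Rightarrow> nat \<Rightarrow> nat set" where
  "acts G s = {a. a < nactions G \<and> loc G a = s}"

definition acts1 :: "tbdg \<Rightarrow> nat set" where
  "acts1 G = (\<Union>s\<in>states1 G. acts G s)"

definition acts2 :: "tbdg \<Rightarrow> nat set" where
  "acts2 G = (\<Union>s\<in>states2 G. acts G s)"

definition TBDG :: "tbdg \<Rightarrow> bool" where
  "TBDG G \<longleftrightarrow>
     states1 G \<union> states2 G = {..<nstates G} \<and> states1 G \<inter> states2 G = {} \<and>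
     (\<forall>a<nactions G. loc G a < nstates G \<and> dest G a < nstates G) \<and>
     (\<forall>s<nstates G. acts G s \<noteq> {}) \<and>
     0 < discount G \<and> discount G < 1"

text \<open>The transition distribution of action \<open>a\<close> is the point mass at \<open>dest a\<close>.\<close>

definition prob :: "tbdg \<Rightarrow> nat \<Rightarrow> nat \<Rightarrow> real" where
  "prob G a t = (if t = dest G a then 1 else 0)"

definition game_graph :: "tbdg \<Rightarrow> (nat, nat) pre_digraph" where
  "game_graph G =
     \<lparr>verts = {..<nstates G}, arcs = {..<nactions G}, tail = loc G, head = dest G\<rparr>"

text \<open>The cycles of \<^const>\<open>pre_digraph.cycle\<close> are simple and include self-loops.\<close>

definition TBDFG :: "tbdg \<Rightarrow> bool" where
  "TBDFG G \<longleftrightarrow> TBDG G \<and>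
     \<not> (\<exists>p. pre_digraph.cycle (game_graph G) p \<and>
            set p \<inter> acts1 G \<noteq> {} \<and> set p \<inter> acts2 G \<noteq> {})"


section \<open>Strategies, values and optimality\<close>

type_synonym strategy = "nat \<Rightarrow> nat"
type_synonym profile = "strategy \<times> strategy"

definition strategies1 :: "tbdg \<Rightarrow> strategy set" where
  "strategies1 G = (\<Pi>\<^sub>E s\<in>states1 G. acts G s)"

definition strategies2 :: "tbdg \<Rightarrow> strategy set" where
  "strategies2 G = (\<Pi>\<^sub>E s\<in>states2 G. acts G s)"

definition played :: "tbdg \<Rightarrow> profile \<Rightarrow> nat \<Rightarrow> nat" where
  "played G \<pi> s = (if s \<in> states1 G then fst \<pi> s else snd \<pi> s)"

definition value_vec :: "tbdg \<Rightarrow> profile \<Rightarrow> nat \<Rightarrow> real" where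
  "value_vec G \<pi> = (THE v. v \<in> extensional {..<nstates G} \<and>
     (\<forall>s<nstates G. v s = cost G (played G \<pi> s)
        + discount G * (\<Sum>t<nstates G. prob G (played G \<pi> s) t * v t)))"

definition reduced_cost :: "tbdg \<Rightarrow> profile \<Rightarrow> nat \<Rightarrow> real" where
  "reduced_cost G \<pi> a =
     cost G a + discount G * (\<Sum>t<nstates G. prob G a t * value_vec G \<pi> t)
       - value_vec G \<pi> (loc G a)"

text \<open>\<open>best_response1 G \<tau> \<sigma>\<close>: the strategy \<open>\<sigma>\<close> is an optimal counter strategy of
  Player 1 (the minimizer) against \<open>\<tau>\<close>; similarly \<open>best_response2 G \<sigma> \<tau>\<close> for Player 2.\<close>

definition best_response1 :: "tbdg \<Rightarrow> strategy \<Rightarrow> strategy \<Rightarrow> bool" where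
  "best_response1 G \<tau> \<sigma> \<longleftrightarrow> \<sigma> \<in> strategies1 G \<and>
     (\<forall>\<sigma>'\<in>strategies1 G. \<forall>s<nstates G. value_vec G (\<sigma>, \<tau>) s \<le> value_vec G (\<sigma>', \<tau>) s)"

definition best_response2 :: "tbdg \<Rightarrow> strategy \<Rightarrow> strategy \<Rightarrow> bool" where
  "best_response2 G \<sigma> \<tau> \<longleftrightarrow> \<tau> \<in> strategies2 G \<and>
     (\<forall>\<tau>'\<in>strategies2 G. \<forall>s<nstates G. value_vec G (\<sigma>, \<tau>') s \<le> value_vec G (\<sigma>, \<tau>) s)"

definition optimal_profile :: "tbdg \<Rightarrow> profile \<Rightarrow> bool" where
  "optimal_profile G \<pi> \<longleftrightarrow>
     best_response1 G (snd \<pi>) (fst \<pi>) \<and> best_response2 G (fst \<pi>) (snd \<pi>)"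


section \<open>The simple strategy-iteration method\<close>

text \<open>
  The method is a nondeterministic transition system, the nondeterminism being the choice
  among tied entering actions. With \<open>\<pi>\<close> the last iterate:
  \<^item> \<open>Iterate \<pi>\<close>: an iteration is about to start;
  \<^item> \<open>Respond \<pi> \<rho>\<close>: Player 1's step has been done, and the simplex method for Player 2 is
    running with current profile \<open>\<rho>\<close>, Player 1's part being held fixed;
  \<^item> \<open>Finished \<pi>\<close>: the method has terminated and returned \<open>\<pi>\<close>.
\<close>

datatype config = Iterate profile | Respond profile profile | Finished profile

definition entering1 :: "tbdg \<Rightarrow> profile \<Rightarrow> nat set" where
  "entering1 G \<pi> = {a \<in> acts1 G. reduced_cost G \<pi> a < 0 \<and>
     (\<forall>b\<in>acts1 G. reduced_cost G \<pi> a \<le> reduced_cost G \<pi> b)}"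

definition entering2 :: "tbdg \<Rightarrow> profile \<Rightarrow> nat set" where
  "entering2 G \<pi> = {a \<in> acts2 G. reduced_cost G \<pi> a > 0 \<and>
     (\<forall>b\<in>acts2 G. reduced_cost G \<pi> b \<le> reduced_cost G \<pi> a)}"

text \<open>The number in the middle is the number of pivot steps made by the transition.\<close>

inductive ssi_step :: "tbdg \<Rightarrow> config \<Rightarrow> nat \<Rightarrow> config \<Rightarrow> bool" for G where
  switch1: "a \<in> entering1 G (\<sigma>, \<tau>) \<Longrightarrow>
    ssi_step G (Iterate (\<sigma>, \<tau>)) 1 (Respond (\<sigma>, \<tau>) (\<sigma>(loc G a := a), \<tau>))"
| stay1: "entering1 G \<pi> = {} \<Longrightarrow> ssi_step G (Iterate \<pi>) 0 (Respond \<pi> \<pi>)"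
| switch2: "a \<in> entering2 G (\<sigma>, \<tau>) \<Longrightarrow>
    ssi_step G (Respond \<pi> (\<sigma>, \<tau>)) 1 (Respond \<pi> (\<sigma>, \<tau>(loc G a := a)))"
| continue: "entering2 G \<rho> = {} \<Longrightarrow> value_vec G \<rho> \<noteq> value_vec G \<pi> \<Longrightarrow>
    ssi_step G (Respond \<pi> \<rho>) 0 (Iterate \<rho>)"
| finish: "entering2 G \<rho> = {} \<Longrightarrow> value_vec G \<rho> = value_vec G \<pi> \<Longrightarrow>
    ssi_step G (Respond \<pi> \<rho>) 0 (Finished \<rho>)"

definition initial :: "tbdg \<Rightarrow> config \<Rightarrow> bool" where
  "initial G c \<longleftrightarrow> (\<exists>\<sigma>\<in>strategies1 G. \<exists>\<tau>. best_response2 G \<sigma> \<tau> \<and> c = Iterate (\<sigma>, \<tau>))"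


section \<open>Arithmetic operations\<close>

text \<open>
  An implementation of a single transition in which every operation on real numbers
  (addition, subtraction, multiplication, division, comparison) is wrapped in \<open>tick\<close>, which
  increments a counter. Only reads of the combinatorial data \<open>loc\<close> and \<open>dest\<close>, table lookups
  and operations on indices are not counted.
\<close>

type_synonym 'a counted = "(nat, 'a) state"

definition tick :: "'a \<Rightarrow> 'a counted" where
  "tick x = State (\<lambda>k. (x, Suc k))"

definition result :: "'a counted \<Rightarrow> 'a" where
  "result p = fst (run_state p 0)"

definition ops :: "'a counted \<Rightarrow> nat" where
  "ops p = snd (run_state p 0)"

text \<open>Total discounted cost of \<open>k\<close> moves from \<open>s\<close>, with terminal cost \<open>x\<close>.\<close>

fun walk_prog :: "tbdg \<Rightarrow> profile \<Rightarrow> nat \<Rightarrow> nat \<Rightarrow> real \<Rightarrow> real counted" where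
  "walk_prog G \<pi> 0 s x = State_Monad.return x"
| "walk_prog G \<pi> (Suc k) s x = do {
     y \<leftarrow> walk_prog G \<pi> k (dest G (played G \<pi> s)) x;
     z \<leftarrow> tick (discount G * y);
     tick (cost G (played G \<pi> s) + z)
   }"

text \<open>
  Follows the cycle through \<open>u\<close>, of length at most the first number given. Started with
  \<open>s = u\<close>, \<open>x = 0\<close> and \<open>g = 1\<close>, it returns the discounted cost of one round and the factor by
  which one round discounts.
\<close>

fun cycle_prog ::
  "tbdg \<Rightarrow> profile \<Rightarrow> nat \<Rightarrow> nat \<Rightarrow> nat \<Rightarrow> real \<Rightarrow> real \<Rightarrow> (real \<times> real) counted" where
  "cycle_prog G \<pi> u 0 s x g = State_Monad.return (x, g)"
| "cycle_prog G \<pi> u (Suc k) s x g = do {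
     y \<leftarrow> tick (g * cost G (played G \<pi> s));
     x' \<leftarrow> tick (x + y);
     g' \<leftarrow> tick (g * discount G);
     let t = dest G (played G \<pi> s);
     if t = u then State_Monad.return (x', g') else cycle_prog G \<pi> u k t x' g'
   }"

text \<open>After \<open>nstates G\<close> moves the play from \<open>s\<close> is on a cycle.\<close>

definition value_at_prog :: "tbdg \<Rightarrow> profile \<Rightarrow> nat \<Rightarrow> real counted" where
  "value_at_prog G \<pi> s = do {
     let u = ((\<lambda>t. dest G (played G \<pi> t)) ^^ nstates G) s;
     (x, g) \<leftarrow> cycle_prog G \<pi> u (nstates G) u 0 1;
     d \<leftarrow> tick (1 - g);
     y \<leftarrow> tick (x / d);
     walk_prog G \<pi> (nstates G) s y
   }"

definition value_prog :: "tbdg \<Rightarrow> profile \<Rightarrow> real list counted" where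
  "value_prog G \<pi> = State_Monad.traverse_list (value_at_prog G \<pi>) [0..<nstates G]"

definition reduced_cost_prog :: "tbdg \<Rightarrow> real list \<Rightarrow> nat \<Rightarrow> real counted" where
  "reduced_cost_prog G vs a = do {
     x \<leftarrow> tick (discount G * vs ! dest G a);
     y \<leftarrow> tick (cost G a + x);
     tick (y - vs ! loc G a)
   }"

fun best_prog :: "(real \<Rightarrow> real \<Rightarrow> bool) \<Rightarrow> real \<Rightarrow> real list \<Rightarrow> real counted" where
  "best_prog better x [] = State_Monad.return x"
| "best_prog better x (y # ys) = do {
     b \<leftarrow> tick (better y x);
     best_prog better (if b then y else x) ys
   }"

definition entering_prog ::
  "tbdg \<Rightarrow> (real \<Rightarrow> real \<Rightarrow> bool) \<Rightarrow> nat list \<Rightarrow> profile \<Rightarrow> nat set counted" where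
  "entering_prog G better as \<pi> = do {
     vs \<leftarrow> value_prog G \<pi>;
     rs \<leftarrow> State_Monad.traverse_list (reduced_cost_prog G vs) as;
     r \<leftarrow> best_prog better 0 rs;
     improving \<leftarrow> tick (better r 0);
     ties \<leftarrow> State_Monad.traverse_list (\<lambda>q. tick (q = r)) rs;
     State_Monad.return (if improving then set (map fst (filter snd (zip as ties))) else {})
   }"

definition entering1_prog :: "tbdg \<Rightarrow> profile \<Rightarrow> nat set counted" where
  "entering1_prog G = entering_prog G (<) (filter (\<lambda>a. loc G a \<in> states1 G) [0..<nactions G])"

definition entering2_prog :: "tbdg \<Rightarrow> profile \<Rightarrow> nat set counted" where
  "entering2_prog G = entering_prog G (>) (filter (\<lambda>a. loc G a \<in> states2 G) [0..<nactions G])"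

definition same_value_prog :: "tbdg \<Rightarrow> profile \<Rightarrow> profile \<Rightarrow> bool counted" where
  "same_value_prog G \<pi> \<rho> = do {
     vs \<leftarrow> value_prog G \<pi>;
     ws \<leftarrow> value_prog G \<rho>;
     eqs \<leftarrow> State_Monad.traverse_list (\<lambda>s. tick (vs ! s = ws ! s)) [0..<nstates G];
     State_Monad.return (\<forall>e\<in>set eqs. e)
   }"

text \<open>The result is the set of all configurations to which the method may move.\<close>

fun ssi_step_prog :: "tbdg \<Rightarrow> config \<Rightarrow> config set counted" where
  "ssi_step_prog G (Iterate (\<sigma>, \<tau>)) = do {
     E \<leftarrow> entering1_prog G (\<sigma>, \<tau>);
     State_Monad.return
       (if E = {} then {Respond (\<sigma>, \<tau>) (\<sigma>, \<tau>)}
        else (\<lambda>a. Respond (\<sigma>, \<tau>) (\<sigma>(loc G a := a), \<tau>)) ` E)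
   }"
| "ssi_step_prog G (Respond \<pi> (\<sigma>, \<tau>)) = do {
     E \<leftarrow> entering2_prog G (\<sigma>, \<tau>);
     if E = {} then do {
       eq \<leftarrow> same_value_prog G \<pi> (\<sigma>, \<tau>);
       State_Monad.return {if eq then Finished (\<sigma>, \<tau>) else Iterate (\<sigma>, \<tau>)}
     }
     else State_Monad.return ((\<lambda>a. Respond \<pi> (\<sigma>, \<tau>(loc G a := a))) ` E)
   }"
| "ssi_step_prog G (Finished \<pi>) = State_Monad.return {}"

text \<open>
  \<open>ssi_exec G c p q c'\<close>: a (partial) execution leads from \<open>c\<close> to \<open>c'\<close>, with \<open>p\<close> pivot steps and
  \<open>q\<close> arithmetic operations in total.
\<close>

inductive ssi_exec :: "tbdg \<Rightarrow> config \<Rightarrow> nat \<Rightarrow> nat \<Rightarrow> config \<Rightarrow> bool" for G c where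
  start: "ssi_exec G c 0 0 c"
| extend: "ssi_exec G c p q c' \<Longrightarrow> ssi_step G c' k c'' \<Longrightarrow>
    ssi_exec G c (p + k) (q + ops (ssi_step_prog G c')) c''"

text \<open>
  However ties are broken, the method started in \<open>c\<close> stops after finitely many transitions, and
  it stops only by returning an optimal profile.
\<close>

definition ssi_converges :: "tbdg \<Rightarrow> config \<Rightarrow> bool" where
  "ssi_converges G c \<longleftrightarrow>
     \<not> (\<exists>f. f 0 = c \<and> (\<forall>i. \<exists>k. ssi_step G (f i) k (f (Suc i)))) \<and>
     (\<forall>p q c'. ssi_exec G c p q c' \<and> \<not> (\<exists>k c''. ssi_step G c' k c'') \<longrightarrow>
        (\<exists>\<pi>. c' = Finished \<pi> \<and> optimal_profile G \<pi>))"

text \<open>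
  On every game of the class, every transition of the method is carried out correctly by
  \<^const>\<open>ssi_step_prog\<close>, and the number of arithmetic operations of every execution is bounded
  by a bivariate polynomial in the numbers of states and actions.
\<close>

definition ssi_strongly_polynomial :: "(tbdg \<Rightarrow> bool) \<Rightarrow> bool" where
  "ssi_strongly_polynomial C \<longleftrightarrow>
     (\<exists>b :: nat poly poly. \<forall>G c p q c'. C G \<and> initial G c \<and> ssi_exec G c p q c' \<longrightarrow>
        result (ssi_step_prog G c') = {c''. \<exists>k. ssi_step G c' k c''} \<and>
        q \<le> poly (poly b [:nactions G:]) (nstates G))"

end

theory Submission
  imports Defs
begin

text \<open>
  Both kinds of pivot steps are instances of one process. A \<^emph>\<open>leader\<close> minimizes; she switches, at a
  single state, to the action of most negative reduced cost, and after every switch the other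
  player, the \<^emph>\<open>follower\<close>, plays a best response. In the outer iteration Player 1 leads. In the inner
  simplex method Player 2 leads, with negated costs, against a follower who has a single action
  at each of his states and who is therefore always at a best response. If a run of this process has
  fewer than \<open>N\<close> pivots (lemma \<open>run_length\<close>), then the method makes at most \<open>N\<close> outer steps, each followed by
  fewer than \<open>N\<close> inner ones, hence at most \<open>N (N + 1)\<close> pivots; and \<open>N\<close> is \<open>O(n\<^sup>3 m\<^sup>2 ln\<^sup>2 n)\<close>.

  To bound the length of a run, measure the progress towards a target profile by the sum over all
  states of the differences of values. Let \<open>- D\<close> be the most negative reduced cost. In a forward game
  a cycle through a state of the leader contains only states of the leader, so that the values on it depend
  on her strategy alone, and the argument for deterministic Markov decision processes survives the
  presence of the follower.

  \<^item> As long as no pivot closes a cycle of the leader, compare with the last profile of this phase. All of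
    its leader cycles are present in the current profile already, so only the moves before the first cycle
    contribute to the distance: it is at most \<open>n\<^sup>2 D\<close>, while a pivot gains \<open>D\<close>
    (lemma \<open>pivot_shrinks_gap\<close>).
  \<^item> For the pivots that do close a cycle, compare with an optimal profile. The distance is at most
    \<open>n D / (1 - \<gamma>)\<close>. The entering action is now used again in every round of the cycle, and
    summed over the states of the cycle this gains \<open>D / (1 - \<gamma>)\<close>
    (lemma \<open>pivot_shrinks_gap_on_cycle\<close>).

  So the distance loses a factor \<open>n\<^sup>2\<close> within about \<open>2 n\<^sup>2 ln n\<close> pivots of the first kind, and within about
  \<open>2 n ln n\<close> pivots of the second kind. On the other hand, at least the fraction \<open>1 / n\<^sup>2\<close> of the distance
  can be blamed on a single action of the leader or on one of her cycles
  (lemma \<open>costly_action_or_cycle\<close>), and the distance stays that large for as long as the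
  culprit is in use. Hence every such block of pivots eliminates an action or a cyclic state for the rest of the
  phase, or an action for the rest of the run (altogether, or from the cycles), which
  can happen at most \<open>m + n\<close> times and at most \<open>2 m\<close> times, respectively.

  An execution of the method stops only when neither player has an improving action, and then the
  profile is optimal. For the number of arithmetic operations, the number of transitions is
  multiplied by the cost of a transition, and \<open>ln n \<le> n\<close> turns the bounds into polynomials.
\<close>

section \<open>Cycles of a self-map and discounted recursions\<close>

definition cyclic :: "('a \<Rightarrow> 'a) \<Rightarrow> 'a \<Rightarrow> bool" where
  "cyclic f x \<longleftrightarrow> (\<exists>k>0. (f ^^ k) x = x)"

lemma cyclic_step: "cyclic f x \<Longrightarrow> cyclic f (f x)"
  unfolding cyclic_def by (metis funpow_swap1)

lemma cyclic_funpow: "cyclic f x \<Longrightarrow> cyclic f ((f ^^ k) x)"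
  by (induction k) (auto intro: cyclic_step)

lemma cyclic_pred:
  assumes "cyclic f x"
  obtains k where "f ((f ^^ k) x) = x"
  using assms unfolding cyclic_def by (metis funpow.simps(2) gr0_conv_Suc o_apply)

text \<open>With the least period no point of the cycle is met twice in one round. This gives both the simple
  cycle required by the definition of a forward game and the fact that \<open>n\<close> moves suffice to go
  once around.\<close>
lemma cyclic_period:
  assumes "cyclic f s"
  obtains k where "0 < k" "(f ^^ k) s = s" "inj_on (\<lambda>i. (f ^^ Suc i) s) {0..<k}"
proof -
  define k where "k = (LEAST k. 0 < k \<and> (f ^^ k) s = s)"
  have k: "0 < k" "(f ^^ k) s = s"
    using LeastI_ex[OF assms[unfolded cyclic_def]] unfolding k_def by auto
  have least: "(f ^^ j) s \<noteq> s" if "0 < j" "j < k" for j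
    using not_less_Least[of j "\<lambda>k. 0 < k \<and> (f ^^ k) s = s"] that unfolding k_def by blast
  have "inj_on (\<lambda>i. (f ^^ Suc i) s) {0..<k}"
  proof (rule linorder_inj_onI)
    fix i j assume ij: "i < j" "i \<in> {0..<k}" "j \<in> {0..<k}"
    show "(f ^^ Suc i) s \<noteq> (f ^^ Suc j) s"
    proof
      assume eq: "(f ^^ Suc i) s = (f ^^ Suc j) s"
      have "(f ^^ (k - Suc j + Suc i)) s = (f ^^ (k - Suc j)) ((f ^^ Suc j) s)"
        by (simp only: funpow_add o_apply eq)
      also have "\<dots> = (f ^^ (k - Suc j + Suc j)) s" by (simp only: funpow_add o_apply)
      also have "\<dots> = s" using ij k by simp
      finally have "(f ^^ (k - Suc j + Suc i)) s = s" .
      moreover have "0 < k - Suc j + Suc i" "k - Suc j + Suc i < k" using ij by auto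
      ultimately show False using least by blast
    qed
  qed auto
  then show ?thesis using that k by blast
qed

lemma funpow_closed: "f ` X \<subseteq> X \<Longrightarrow> x \<in> X \<Longrightarrow> (f ^^ k) x \<in> X"
  by (induction k) auto

lemma funpow_agree:
  assumes "f ` X \<subseteq> X" "x \<in> X" "\<And>y. y \<in> X \<Longrightarrow> g y = f y"
  shows "(g ^^ k) x = (f ^^ k) x"
  using funpow_closed[OF assms(1,2)] assms(3) by (induction k) auto

lemma cyclic_agree:
  assumes "f ` X \<subseteq> X" "x \<in> X" "\<And>y. y \<in> X \<Longrightarrow> g y = f y" "cyclic f x"
  shows "cyclic g x"
  using assms funpow_agree[OF assms(1-3)] unfolding cyclic_def by simp

text \<open>Among the \<open>n + 1\<close> states visited by \<open>n\<close> moves two coincide, and the first of the two is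
  reached after at most \<open>n - 1\<close> moves.\<close>
lemma cyclic_after:
  fixes s :: nat
  assumes f: "f ` {..<n} \<subseteq> {..<n}" and s: "s < n"
  shows "cyclic f ((f ^^ (n - 1)) s)"
proof -
  have in_n: "(f ^^ i) s < n" for i
    using funpow_closed[OF f, of s i] s by simp
  have "\<not> inj_on (\<lambda>i. (f ^^ i) s) {..n}"
  proof
    assume "inj_on (\<lambda>i. (f ^^ i) s) {..n}"
    then have "card {..n} \<le> card {..<n}"
      by (rule card_inj_on_le) (use in_n in auto)
    then show False by simp
  qed
  then obtain i j where ij: "i < j" "j \<le> n" "(f ^^ i) s = (f ^^ j) s"
    unfolding inj_on_def by (metis atMost_iff nat_neq_iff)
  have "(f ^^ (j - i)) ((f ^^ i) s) = (f ^^ i) s"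
    using ij by (metis add_diff_inverse_nat funpow_add less_imp_not_less o_apply add.commute)
  then have "cyclic f ((f ^^ i) s)"
    unfolding cyclic_def using ij by (intro exI[of _ "j - i"]) simp
  then have "cyclic f ((f ^^ (n - 1 - i)) ((f ^^ i) s))"
    by (rule cyclic_funpow)
  moreover have "(f ^^ (n - 1 - i)) ((f ^^ i) s) = (f ^^ (n - 1)) s"
    using ij funpow_add[of "n - 1 - i" i f] by simp
  ultimately show ?thesis by simp
qed

text \<open>On a closed set of cyclic points the map is onto, because every point is reached from its predecessor
  on the cycle; so sums over such a set are invariant under a move.\<close>
lemma bij_betw_cyclic:
  assumes "finite X" "f ` X \<subseteq> X" "\<And>x. x \<in> X \<Longrightarrow> cyclic f x"
  shows "bij_betw f X X"
proof -
  have "X \<subseteq> f ` X"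
  proof
    fix x assume x: "x \<in> X"
    obtain k where "f ((f ^^ k) x) = x" using cyclic_pred assms(3)[OF x] by metis
    moreover have "(f ^^ k) x \<in> X" using assms(2) x by (rule funpow_closed)
    ultimately show "x \<in> f ` X" by (metis imageI)
  qed
  then have "f ` X = X" using assms(2) by blast
  then show ?thesis
    using assms(1) by (simp add: bij_betw_def eq_card_imp_inj_on)
qed

text \<open>The comparison principle behind all inequalities between values: at a point where \<open>d\<close> is
  maximal, \<open>d \<le> \<gamma> d\<close>.\<close>
lemma discounted_nonpos:
  fixes d :: "'a \<Rightarrow> real"
  assumes X: "finite X" "f ` X \<subseteq> X" and g: "0 \<le> \<gamma>" "\<gamma> < 1"
    and d: "\<And>x. x \<in> X \<Longrightarrow> d x \<le> \<gamma> * d (f x)" and x: "x \<in> X"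
  shows "d x \<le> 0"
proof -
  define D where "D = Max (d ` X)"
  have le: "d y \<le> D" if "y \<in> X" for y
    unfolding D_def using X that by simp
  have "D \<in> d ` X" unfolding D_def using X x by (intro Max_in) auto
  then obtain y where y: "y \<in> X" "D = d y" by auto
  have "D \<le> \<gamma> * d (f y)" using d y by simp
  also have "\<dots> \<le> \<gamma> * D" using le X y g by (intro mult_left_mono) auto
  finally have "D * (1 - \<gamma>) \<le> 0" by (simp add: algebra_simps)
  then have "D \<le> 0" using g by (simp add: mult_le_0_iff)
  then show ?thesis using le[OF x] by simp
qed

text \<open>An amount \<open>w x\<close> collected at a point of a cycle is collected again in every round by each
  starting point of the cycle; with all starting points together, every power of \<open>\<gamma>\<close>
  occurs once, which gives the factor \<open>1 / (1 - \<gamma>)\<close> whatever the length of the cycle.\<close>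
lemma discounted_sum_cyclic:
  fixes d w :: "'a \<Rightarrow> real"
  assumes X: "finite X" "f ` X \<subseteq> X" "\<And>x. x \<in> X \<Longrightarrow> cyclic f x"
    and d: "\<And>x. x \<in> X \<Longrightarrow> d x = w x + \<gamma> * d (f x)"
  shows "(1 - \<gamma>) * sum d X = sum w X"
proof -
  have "sum d X = sum w X + \<gamma> * (\<Sum>x\<in>X. d (f x))"
    using d by (simp add: sum.distrib sum_distrib_left)
  also have "(\<Sum>x\<in>X. d (f x)) = sum d X"
    using bij_betw_cyclic[OF X] by (rule sum.reindex_bij_betw)
  finally show ?thesis by (simp add: algebra_simps)
qed

lemma discounted_unroll:
  fixes d w :: "'a \<Rightarrow> real"
  assumes X: "f ` X \<subseteq> X" "x \<in> X" and d: "\<And>x. x \<in> X \<Longrightarrow> d x = w x + \<gamma> * d (f x)"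
  shows "d x = (\<Sum>i<k. \<gamma> ^ i * w ((f ^^ i) x)) + \<gamma> ^ k * d ((f ^^ k) x)"
proof (induction k)
  case (Suc k)
  have "d ((f ^^ k) x) = w ((f ^^ k) x) + \<gamma> * d (f ((f ^^ k) x))"
    using d funpow_closed[OF X] by blast
  then show ?case using Suc by (simp add: algebra_simps)
qed simp

text \<open>The solution is the discounted series along the orbit.\<close>
lemma discounted_solution:
  fixes w :: "'a \<Rightarrow> real"
  assumes X: "finite X" "f ` X \<subseteq> X" and g: "0 \<le> \<gamma>" "\<gamma> < 1"
  obtains d where "\<And>x. x \<in> X \<Longrightarrow> d x = w x + \<gamma> * d (f x)"
proof
  define d where "d x = (\<Sum>i. \<gamma> ^ i * w ((f ^^ i) x))" for x
  fix x assume x: "x \<in> X"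
  define B where "B = Max ((\<lambda>x. \<bar>w x\<bar>) ` X)"
  have B: "\<bar>w y\<bar> \<le> B" if "y \<in> X" for y
    unfolding B_def using X that by simp
  have sm: "summable (\<lambda>i. \<gamma> ^ i * w ((f ^^ i) x))"
  proof (rule summable_comparison_test')
    show "summable (\<lambda>i. \<gamma> ^ i * B)"
      using g by (intro summable_mult2 summable_geometric) simp
    show "norm (\<gamma> ^ i * w ((f ^^ i) x)) \<le> \<gamma> ^ i * B" for i
      using g B[OF funpow_closed[OF X(2) x]] by (simp add: abs_mult mult_left_mono)
  qed
  have sm': "summable (\<lambda>i. \<gamma> ^ i * w ((f ^^ i) (f x)))"
  proof (rule summable_comparison_test')
    show "summable (\<lambda>i. \<gamma> ^ i * B)"
      using g by (intro summable_mult2 summable_geometric) simp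
    show "norm (\<gamma> ^ i * w ((f ^^ i) (f x))) \<le> \<gamma> ^ i * B" for i
      using g B[OF funpow_closed[OF X(2), of "f x"]] x X(2)
      by (simp add: abs_mult mult_left_mono image_subset_iff)
  qed
  have "d x = w x + (\<Sum>i. \<gamma> ^ Suc i * w ((f ^^ Suc i) x))"
    unfolding d_def using suminf_split_head[OF sm] by simp
  also have "(\<lambda>i. \<gamma> ^ Suc i * w ((f ^^ Suc i) x)) = (\<lambda>i. \<gamma> * (\<gamma> ^ i * w ((f ^^ i) (f x))))"
    by (simp add: funpow_swap1 mult.assoc)
  also have "(\<Sum>i. \<gamma> * (\<gamma> ^ i * w ((f ^^ i) (f x)))) = \<gamma> * d (f x)"
    unfolding d_def using sm' by (rule suminf_mult)
  finally show "d x = w x + \<gamma> * d (f x)" .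
qed

section \<open>Counting by elimination\<close>

text \<open>The clock \<open>h\<close> counts the relevant pivots among the first \<open>l\<close> ones, and \<open>tok l\<close> is the set of tokens
  (actions, cyclic states) in use at time \<open>l\<close>. Whenever the clock advances by \<open>b\<close>, a token that was in use
  goes out of use for good, so the set of tokens that are still to be used shrinks.\<close>
lemma length_less_by_elimination:
  fixes h :: "nat \<Rightarrow> nat" and tok :: "nat \<Rightarrow> 'b set"
  assumes h: "h 0 = 0" "\<And>l. h l \<le> h (Suc l)" "\<And>l. h (Suc l) \<le> Suc (h l)"
    and tok: "finite X" "card X \<le> N" "\<And>l. l \<le> T \<Longrightarrow> tok l \<subseteq> X" and b: "0 < b"
    and elim: "\<And>i. i \<le> T \<Longrightarrow> h i + b \<le> h T \<Longrightarrow>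
      \<exists>x\<in>tok i. \<forall>l\<le>T. h i + b \<le> h l \<longrightarrow> x \<notin> tok l"
  shows "h T < b * (N + 1)"
proof -
  define U where "U i = (\<Union>l\<in>{i..T}. tok l)" for i
  have UX: "U i \<subseteq> X" for i unfolding U_def using tok(3) by fastforce
  then have finU: "finite (U i)" for i using tok finite_subset by blast
  have mono: "h i \<le> h j" if "i \<le> j" for i j
    using that h(2) by (rule lift_Suc_mono_le[rotated])
  have main: "h T < h i + b * (card (U i) + 1)" if "i \<le> T" for i
    using that
  proof (induction "card (U i)" arbitrary: i rule: less_induct)
    case less
    show ?case
    proof (cases "h i + b \<le> h T")
      case True
      define l where "l = (LEAST l. h i + b \<le> h l)"
      have l: "h i + b \<le> h l" unfolding l_def using True by (rule LeastI)
      have lT: "l \<le> T" unfolding l_def using True by (rule Least_le)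
      have "l \<noteq> 0" using l b h(1) by (cases "l = 0") auto
      then obtain l' where l': "l = Suc l'" using not0_implies_Suc by blast
      have "h l' < h i + b" using l' not_less_Least[of l' "\<lambda>l. h i + b \<le> h l"]
        unfolding l_def by (metis lessI not_le)
      \<comment> \<open>The clock advances by unit steps, so it hits \<open>h i + b\<close> exactly.\<close>
      then have hl: "h l = h i + b" using l l' h(3)[of l'] by simp
      have il: "i \<le> l" using hl b mono[of l i] by (cases "i \<le> l") auto
      obtain x where x: "x \<in> tok i" "\<forall>l\<le>T. h i + b \<le> h l \<longrightarrow> x \<notin> tok l"
        using elim[OF less.prems True] by blast
      have "x \<in> U i" "x \<notin> U l" "U l \<subseteq> U i"
        unfolding U_def using x less.prems il mono hl by fastforce+
      then have card: "card (U l) < card (U i)"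
        by (intro psubset_card_mono finU) blast
      have "h T < h l + b * (card (U l) + 1)"
        using less.hyps[OF card lT] .
      also have "\<dots> \<le> h l + b * card (U i)" using card by (simp del: mult_Suc_right)
      finally show ?thesis using hl by simp
    qed (use b in auto)
  qed
  have "card (U 0) \<le> N" using card_mono[OF tok(1) UX[of 0]] tok(2) by simp
  then have "b * (card (U 0) + 1) \<le> b * (N + 1)" by simp
  moreover have "h T < b * (card (U 0) + 1)" using main[of 0] h(1) by simp
  ultimately show ?thesis by (rule less_le_trans[rotated])
qed

lemma length_less_by_phases:
  fixes E :: "nat set"
  assumes "E \<subseteq> {..<T}"
    and "\<And>i j. i \<le> j \<Longrightarrow> j \<le> T \<Longrightarrow> {i..<j} \<inter> E = {} \<Longrightarrow> j - i < L"
  shows "T < (card E + 1) * L"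
  using assms
proof (induction "card E" arbitrary: E T)
  case 0
  then have "E = {}" using finite_subset[OF 0(2)] by simp
  then show ?case using 0(3)[of 0 T] by simp
next
  case (Suc k)
  have fin: "finite E" using Suc.prems(1) finite_subset by blast
  then have ne: "E \<noteq> {}" using Suc(2) by auto
  define t where "t = Max E"
  have t: "t \<in> E" unfolding t_def using fin ne by simp
  have le: "\<And>e. e \<in> E \<Longrightarrow> e \<le> t" unfolding t_def using fin by simp
  have tT: "t < T" using t Suc.prems by auto
  have "k = card (E - {t})" using Suc(2) t fin by simp
  then have "t < (card (E - {t}) + 1) * L"
  proof (rule Suc(1))
    show "E - {t} \<subseteq> {..<t}" using le by fastforce
    fix i j assume ij: "i \<le> j" "j \<le> t" "{i..<j} \<inter> (E - {t}) = {}"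
    then have "{i..<j} \<inter> E = {}" by auto
    then show "j - i < L" using ij tT Suc.prems(2)[of i j] by simp
  qed
  moreover have "T - Suc t < L"
    using Suc.prems(2)[of "Suc t" T] tT le by fastforce
  moreover have "card E = Suc (card (E - {t}))" using t fin by (metis card_Suc_Diff1)
  ultimately show ?case using tT by (simp add: algebra_simps)
qed

text \<open>By \<open>1 - 1/a \<le> exp (- 1/a)\<close>, more than \<open>2 a ln n\<close> factors \<open>1 - 1/a\<close> amount to less than
  \<open>1 / n\<^sup>2\<close>.\<close>
lemma geometric_decay:
  fixes a n :: real
  assumes "1 \<le> a" "1 \<le> n" "2 * a * ln n < real k"
  shows "(1 - 1 / a) ^ k < 1 / n\<^sup>2"
proof -
  have "(1 - 1 / a) ^ k \<le> exp (- (1 / a)) ^ k"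
    using assms exp_ge_add_one_self[of "- (1/a)"] by (intro power_mono) auto
  also have "\<dots> = exp (- (real k / a))" by (simp add: exp_of_nat_mult[symmetric])
  also have "\<dots> < exp (- (2 * ln n))" using assms by (simp add: field_simps)
  also have "\<dots> = 1 / n\<^sup>2"
    using assms by (simp add: exp_minus inverse_eq_divide exp_of_nat_mult[of 2, simplified])
  finally show ?thesis .
qed

lemma decay_along:
  fixes G :: "nat \<Rightarrow> real"
  assumes h: "\<And>l. h l \<le> h (Suc l)" "\<And>l. h (Suc l) \<le> Suc (h l)" and q: "0 \<le> q" "q \<le> 1"
    and ij: "i \<le> j" and nonneg: "\<And>l. l \<le> j \<Longrightarrow> 0 \<le> G l"
    and dec: "\<And>l. l < j \<Longrightarrow> G (Suc l) \<le> G l"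
    and dec': "\<And>l. l < j \<Longrightarrow> i \<le> l \<Longrightarrow> h (Suc l) = Suc (h l) \<Longrightarrow> G (Suc l) \<le> q * G l"
  shows "G j \<le> q ^ (h j - h i) * G i"
  using ij nonneg dec dec'
proof (induction rule: dec_induct)
  case base then show ?case by simp
next
  case (step l)
  have IH: "G l \<le> q ^ (h l - h i) * G i" using step by simp
  have le: "h i \<le> h l" using step(1) h(1) by (rule lift_Suc_mono_le[rotated])
  show ?case
  proof (cases "h (Suc l) = h l")
    case True
    then show ?thesis using IH step.prems(2)[of l] by simp
  next
    case False
    then have e: "h (Suc l) = Suc (h l)" using h[of l] by simp
    then have "G (Suc l) \<le> q * G l" using step by simp
    also have "\<dots> \<le> q * (q ^ (h l - h i) * G i)" using IH q by (intro mult_left_mono)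
    finally show ?thesis using e le by (simp add: Suc_diff_le mult.assoc)
  qed
qed

section \<open>Pivoting against best responses\<close>

text \<open>One leader with states \<open>L\<close> and, at all other states, a follower. The sets \<open>A s\<close> of available actions
  are a parameter, so that a player whose strategy is held fixed is a follower with singleton sets. The last
  assumption is forwardness in terms of policies: on a cycle the play does not change
  hands.\<close>
locale forward_game =
  fixes n m :: nat and L :: "nat set" and A :: "nat \<Rightarrow> nat set"
    and loc dest :: "nat \<Rightarrow> nat" and c :: "nat \<Rightarrow> real" and \<gamma> :: real
  assumes leader_states: "L \<subseteq> {..<n}"
    and A_nonempty: "\<And>s. s < n \<Longrightarrow> A s \<noteq> {}"
    and A_bounded: "\<And>s a. s < n \<Longrightarrow> a \<in> A s \<Longrightarrow> a < m"
    and A_loc: "\<And>s a. s < n \<Longrightarrow> a \<in> A s \<Longrightarrow> loc a = s"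
    and A_dest: "\<And>s a. s < n \<Longrightarrow> a \<in> A s \<Longrightarrow> dest a < n"
    and discount: "0 < \<gamma>" "\<gamma> < 1"
    and forward: "\<And>p s. (\<And>t. t < n \<Longrightarrow> p t \<in> A t) \<Longrightarrow> s < n \<Longrightarrow>
      cyclic (\<lambda>t. dest (p t)) s \<Longrightarrow> s \<in> L \<longleftrightarrow> dest (p s) \<in> L"
begin

abbreviation nxt :: "(nat \<Rightarrow> nat) \<Rightarrow> nat \<Rightarrow> nat" where
  "nxt p \<equiv> \<lambda>s. dest (p s)"

definition policy :: "(nat \<Rightarrow> nat) \<Rightarrow> bool" where
  "policy p \<longleftrightarrow> (\<forall>s<n. p s \<in> A s)"

definition red :: "(nat \<Rightarrow> real) \<Rightarrow> nat \<Rightarrow> real" where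
  "red v a = c a + \<gamma> * v (dest a) - v (loc a)"

definition value_of :: "(nat \<Rightarrow> nat) \<Rightarrow> (nat \<Rightarrow> real) \<Rightarrow> bool" where
  "value_of p v \<longleftrightarrow> (\<forall>s<n. v s = c (p s) + \<gamma> * v (dest (p s)))"

text \<open>Values are kept apart from policies and characterized by their equation. In an answered policy no
  action of the follower, who maximizes, has positive reduced cost: he is at a best response.\<close>
definition answered :: "(nat \<Rightarrow> nat) \<Rightarrow> (nat \<Rightarrow> real) \<Rightarrow> bool" where
  "answered p v \<longleftrightarrow> policy p \<and> value_of p v \<and> (\<forall>s\<in>{..<n} - L. \<forall>a\<in>A s. red v a \<le> 0)"

text \<open>The follower's part of \<open>p'\<close> is not tied to that of \<open>p\<close>: one step comprises the leader's switch and
  the follower's reaction to it.\<close>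
fun pivot :: "(nat \<Rightarrow> nat) \<times> (nat \<Rightarrow> real) \<Rightarrow> (nat \<Rightarrow> nat) \<times> (nat \<Rightarrow> real) \<Rightarrow> bool" where
  "pivot (p, v) (p', v') \<longleftrightarrow> answered p v \<and> answered p' v' \<and>
     (\<exists>s\<in>L. red v (p' s) < 0 \<and> (\<forall>t\<in>L. \<forall>a\<in>A t. red v (p' s) \<le> red v a) \<and>
        (\<forall>t\<in>L. t \<noteq> s \<longrightarrow> p' t = p t))"

definition cycles :: "(nat \<Rightarrow> nat) \<Rightarrow> nat set" where
  "cycles p = {s \<in> L. cyclic (nxt p) s}"

lemma L_less: "s \<in> L \<Longrightarrow> s < n"
  using leader_states by auto

lemma policyD: "policy p \<Longrightarrow> s < n \<Longrightarrow> p s \<in> A s"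
  unfolding policy_def by blast

lemma nxt_closed: "policy p \<Longrightarrow> nxt p ` {..<n} \<subseteq> {..<n}"
  using A_dest unfolding policy_def by auto

lemma nxt_less: "policy p \<Longrightarrow> s < n \<Longrightarrow> dest (p s) < n"
  using nxt_closed by auto

lemma forward': "policy p \<Longrightarrow> s < n \<Longrightarrow> cyclic (nxt p) s \<Longrightarrow> s \<in> L \<longleftrightarrow> dest (p s) \<in> L"
  by (rule forward) (simp_all add: policyD)

lemma finite_cycles: "finite (cycles p)"
  by (rule finite_subset[OF _ finite_lessThan[of n]]) (use leader_states in \<open>auto simp: cycles_def\<close>)

lemma cycles_closed: "policy p \<Longrightarrow> nxt p ` cycles p \<subseteq> cycles p"
proof
  fix t assume p: "policy p" and "t \<in> nxt p ` cycles p"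
  then obtain s where s: "t = nxt p s" "s \<in> L" "cyclic (nxt p) s" unfolding cycles_def by blast
  have "t \<in> L" using forward'[OF p L_less[OF s(2)] s(3)] s(1,2) by simp
  moreover have "cyclic (nxt p) t" unfolding s(1) using s(3) by (rule cyclic_step)
  ultimately show "t \<in> cycles p" unfolding cycles_def by simp
qed

lemma cycles_cyclic: "s \<in> cycles p \<Longrightarrow> cyclic (nxt p) s"
  unfolding cycles_def by simp

lemma cycles_less: "s \<in> cycles p \<Longrightarrow> s < n"
  unfolding cycles_def using L_less by blast

lemma cycles_leader: "s \<in> cycles p \<Longrightarrow> s \<in> L"
  unfolding cycles_def by blast

text \<open>The whole orbit of a leader's cyclic state belongs to the leader, so the cycle persists under every
  change of the policy elsewhere, in particular under every change made by the follower.\<close>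
lemma cycles_subset:
  assumes "policy p" "\<And>s. s \<in> cycles p \<Longrightarrow> q s = p s"
  shows "cycles p \<subseteq> cycles q"
proof
  fix s assume s: "s \<in> cycles p"
  have "cyclic (nxt q) s"
    by (rule cyclic_agree[OF cycles_closed[OF assms(1)] s]) (use assms(2) s cycles_cyclic in auto)
  then show "s \<in> cycles q" using s unfolding cycles_def by simp
qed

lemma answeredD:
  assumes "answered p v"
  shows "policy p" "value_of p v" "\<And>s a. s < n \<Longrightarrow> s \<notin> L \<Longrightarrow> a \<in> A s \<Longrightarrow> red v a \<le> 0"
  using assms unfolding answered_def by auto

lemma red_at: "policy p \<Longrightarrow> s < n \<Longrightarrow> red v (p s) = c (p s) + \<gamma> * v (dest (p s)) - v s"
  using A_loc unfolding red_def policy_def by simp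

lemma value_ofD: "value_of p v \<Longrightarrow> s < n \<Longrightarrow> v s = c (p s) + \<gamma> * v (dest (p s))"
  unfolding value_of_def by blast

lemma red_zero: "policy p \<Longrightarrow> value_of p v \<Longrightarrow> s < n \<Longrightarrow> red v (p s) = 0"
  using value_ofD[of p v s] red_at[of p s v] by linarith

text \<open>The change of value from one policy to another satisfies the discounted recursion of the new play, the
  inhomogeneity being the reduced costs of the new actions with respect to the old values.\<close>
lemma value_diff:
  assumes "policy p'" "value_of p' v'" "s < n"
  shows "v' s - v s = red v (p' s) + \<gamma> * (v' (dest (p' s)) - v (dest (p' s)))"
  using value_ofD[OF assms(2,3)] red_at[OF assms(1,3), of v] unfolding right_diff_distrib by linarith

lemma follower_red:
  assumes "answered p v" "policy q" "s < n" "s \<notin> L"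
  shows "red v (q s) \<le> 0"
  using answeredD(3)[OF assms(1)] assms(2-4) unfolding policy_def by blast

lemma pivotE:
  assumes "pivot (p, v) (p', v')"
  obtains s where "answered p v" "answered p' v'" "s \<in> L" "red v (p' s) < 0"
    "\<And>t a. t \<in> L \<Longrightarrow> a \<in> A t \<Longrightarrow> red v (p' s) \<le> red v a"
    "\<And>t. t \<in> L \<Longrightarrow> t \<noteq> s \<Longrightarrow> p' t = p t"
  using assms by auto

text \<open>The new actions are the entering one, unchanged actions of the leader, and actions of the follower,
  which cannot be profitable for him against the old values because he was at a best response.\<close>
lemma pivot_red_nonpos:
  assumes "pivot (p, v) (p', v')" "t < n"
  shows "red v (p' t) \<le> 0"
proof -
  obtain s where s: "answered p v" "answered p' v'" "red v (p' s) < 0"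
    "\<And>t. t \<in> L \<Longrightarrow> t \<noteq> s \<Longrightarrow> p' t = p t"
    using assms(1) by (elim pivotE) blast
  show ?thesis
  proof (cases "t \<in> L \<and> t \<noteq> s")
    case True
    then show ?thesis using s red_zero[OF answeredD(1,2)[OF s(1)] assms(2)] by simp
  next
    case False
    then show ?thesis using s follower_red[OF s(1) answeredD(1)[OF s(2)] assms(2)] by fastforce
  qed
qed

text \<open>If no action of the new policy has positive reduced cost, no value increases; the
  successor of \<open>s\<close> being no worse than before, the reduced cost at \<open>s\<close> itself is a net gain for the leader.\<close>
lemma value_gain_of_red:
  assumes p': "policy p'" "value_of p' v'" and red: "\<And>t. t < n \<Longrightarrow> red v (p' t) \<le> 0" and s: "s < n"
  shows "v' s \<le> v s + red v (p' s)"
proof -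
  have "v' t - v t \<le> 0" if "t < n" for t
  proof (rule discounted_nonpos[where X = "{..<n}" and f = "nxt p'" and \<gamma> = \<gamma>])
    fix x assume "x \<in> {..<n}"
    then show "v' x - v x \<le> \<gamma> * (v' (nxt p' x) - v (nxt p' x))"
      using value_diff[OF p', of x v] red[of x] by simp
  qed (use p' that nxt_closed discount in auto)
  then have "\<gamma> * (v' (dest (p' s)) - v (dest (p' s))) \<le> 0"
    using nxt_less[OF p'(1) s] discount by (intro mult_nonneg_nonpos) auto
  then show ?thesis using value_diff[OF p' s, of v] by linarith
qed

lemma value_loss_of_red:
  assumes p': "policy p'" "value_of p' v'" and red: "\<And>t. t < n \<Longrightarrow> 0 \<le> red v (p' t)" and s: "s < n"
  shows "v s + red v (p' s) \<le> v' s"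
proof -
  have "v t - v' t \<le> 0" if "t < n" for t
  proof (rule discounted_nonpos[where X = "{..<n}" and f = "nxt p'" and \<gamma> = \<gamma>])
    fix x assume "x \<in> {..<n}"
    then show "v x - v' x \<le> \<gamma> * (v (nxt p' x) - v' (nxt p' x))"
      using value_diff[OF p', of x v] red[of x] unfolding right_diff_distrib by simp
  qed (use p' that nxt_closed discount in auto)
  then have "0 \<le> \<gamma> * (v' (dest (p' s)) - v (dest (p' s)))"
    using nxt_less[OF p'(1) s] discount by simp
  then show ?thesis using value_diff[OF p' s, of v] by linarith
qed

lemma pivot_gain:
  assumes "pivot (p, v) (p', v')" "t < n"
  shows "v' t \<le> v t + red v (p' t)"
  using assms pivot_red_nonpos[OF assms(1)] by (intro value_gain_of_red) (auto dest: answeredD)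

lemma pivot_mono:
  assumes "pivot (p, v) (p', v')" "t < n"
  shows "v' t \<le> v t"
proof -
  have "v' t \<le> v t + red v (p' t)" using assms by (rule pivot_gain)
  then show ?thesis using pivot_red_nonpos[OF assms] by simp
qed

text \<open>The distance of \<open>(p, v)\<close> from a target \<open>(q, w)\<close> is estimated along the play in which the leader plays
  as in the target and the follower as at present. The follower's present strategy is no better
  against \<open>q\<close> than his best response, so replacing the latter by the former can only lower the target value
  and thus only enlarge the distance.\<close>
definition mix :: "(nat \<Rightarrow> nat) \<Rightarrow> (nat \<Rightarrow> nat) \<Rightarrow> nat \<Rightarrow> nat" where
  "mix p q s = (if s \<in> L then q s else p s)"

lemma policy_mix: "policy p \<Longrightarrow> policy q \<Longrightarrow> policy (mix p q)"
  unfolding policy_def mix_def by simp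

lemma gap_recursion:
  assumes pv: "answered p v" and qw: "answered q w" and s: "s < n"
  shows "v s - w s \<le> (if s \<in> L then - red v (q s) else 0) + \<gamma> * (v (nxt (mix p q) s) - w (nxt (mix p q) s))"
proof (cases "s \<in> L")
  case True
  then show ?thesis
    using value_diff[OF answeredD(1,2)[OF qw] s, of v] unfolding mix_def right_diff_distrib by simp
next
  case False
  have "red w (p s) \<le> 0" using follower_red[OF qw answeredD(1)[OF pv] s False] .
  then show ?thesis
    using False value_diff[OF answeredD(1,2)[OF pv] s, of w] unfolding mix_def right_diff_distrib by simp
qed

text \<open>Every move of the mixed play contributes at most \<open>D\<close>, so the distance is at most
  \<open>D / (1 - \<gamma>)\<close>.\<close>
lemma gap_le:
  assumes pv: "answered p v" and qw: "answered q w" and s: "s < n"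
    and D: "0 \<le> D" "\<And>t a. t \<in> L \<Longrightarrow> a \<in> A t \<Longrightarrow> - D \<le> red v a"
  shows "(1 - \<gamma>) * (v s - w s) \<le> D"
proof -
  define e where "e t = v t - w t - D / (1 - \<gamma>)" for t
  have "e s \<le> 0"
  proof (rule discounted_nonpos[where X = "{..<n}" and f = "nxt (mix p q)" and \<gamma> = \<gamma>])
    show "nxt (mix p q) ` {..<n} \<subseteq> {..<n}"
      by (intro nxt_closed policy_mix answeredD(1)[OF pv] answeredD(1)[OF qw])
    fix t assume t: "t \<in> {..<n}"
    have "- D \<le> red v (q t)" if "t \<in> L"
      using D(2)[OF that] answeredD(1)[OF qw] t unfolding policy_def by blast
    then have "v t - w t \<le> D + \<gamma> * (v (nxt (mix p q) t) - w (nxt (mix p q) t))"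
      using gap_recursion[OF pv qw, of t] t D(1) by (auto split: if_splits)
    moreover have "D = (1 - \<gamma>) * (D / (1 - \<gamma>))" using discount by simp
    ultimately show "e t \<le> \<gamma> * e (nxt (mix p q) t)"
      unfolding e_def left_diff_distrib right_diff_distrib by linarith
  qed (use s discount in auto)
  then show ?thesis using discount by (simp add: e_def field_simps)
qed

text \<open>Once the mixed play is on a cycle, it contributes nothing more to the distance: on a cycle of the
  leader, \<open>p\<close> and \<open>q\<close> coincide, and at the states of the follower there is never a contribution. The
  cycle is reached in fewer than \<open>n\<close> moves.\<close>
lemma gap_le_of_cycles:
  assumes pv: "answered p v" and qw: "answered q w" and s: "s < n"
    and cycles: "\<And>t. t \<in> cycles q \<Longrightarrow> p t = q t"
    and D: "0 \<le> D" "\<And>t a. t \<in> L \<Longrightarrow> a \<in> A t \<Longrightarrow> - D \<le> red v a"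
  shows "v s - w s \<le> real n * D"
proof -
  let ?f = "nxt (mix p q)" and ?d = "\<lambda>t. v t - w t"
  note pol = answeredD(1)[OF pv] answeredD(1)[OF qw]
  have polm: "policy (mix p q)" using pol by (rule policy_mix)
  have f: "?f ` {..<n} \<subseteq> {..<n}" using polm by (rule nxt_closed)
  have "cycles (mix p q) \<subseteq> cycles q"
    by (rule cycles_subset[OF polm]) (simp add: mix_def cycles_leader)
  then have zero: "red v (q t) = 0" if "t \<in> cycles (mix p q)" for t
    using that cycles[of t] red_zero[OF answeredD(1,2)[OF pv] cycles_less[OF that]] by auto
  define C where "C = {t. t < n \<and> cyclic ?f t}"
  have C: "finite C" "?f ` C \<subseteq> C"
    unfolding C_def using nxt_less[OF polm] cyclic_step[of ?f] by auto
  have on_cycle: "?d t \<le> 0" if "t \<in> C" for t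
  proof (rule discounted_nonpos[where X = C and f = ?f and \<gamma> = \<gamma>])
    fix x assume x: "x \<in> C"
    then have "x \<in> L \<Longrightarrow> x \<in> cycles (mix p q)" unfolding C_def cycles_def by simp
    then show "?d x \<le> \<gamma> * ?d (?f x)"
      using gap_recursion[OF pv qw, of x] x zero unfolding C_def by (auto split: if_splits)
  qed (use C discount that in auto)
  have step: "?d t \<le> D + \<gamma> * ?d (?f t)" if "t < n" for t
  proof -
    have "- D \<le> red v (q t)" if "t \<in> L"
      using D(2)[OF that] pol(2) \<open>t < n\<close> unfolding policy_def by blast
    then show ?thesis using gap_recursion[OF pv qw that] D(1) by (auto split: if_splits)
  qed
  have path: "?d t \<le> real k * D" if "t < n" "(?f ^^ k) t \<in> C" for k t
    using that
  proof (induction k arbitrary: t)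
    case 0 then show ?case using on_cycle by simp
  next
    case (Suc k)
    have "?d (?f t) \<le> real k * D"
      using Suc f by (intro Suc.IH) (auto simp: funpow_Suc_right simp del: funpow.simps(2))
    then have "\<gamma> * ?d (?f t) \<le> \<gamma> * (real k * D)" using discount by simp
    also have "\<dots> \<le> real k * D" using discount D(1) by (intro mult_left_le_one_le) auto
    finally show ?case using step[OF Suc.prems(1)] by (simp add: algebra_simps)
  qed
  have "(?f ^^ (n - 1)) s \<in> C"
    using cyclic_after[OF f s] funpow_closed[OF f, of s] s unfolding C_def by auto
  then have "?d s \<le> real (n - 1) * D" using path s by blast
  also have "\<dots> \<le> real n * D" using D(1) by (intro mult_right_mono) auto
  finally show ?thesis .
qed

section \<open>Actions and cycles that must disappear\<close>

definition gap :: "(nat \<Rightarrow> real) \<Rightarrow> (nat \<Rightarrow> real) \<Rightarrow> real" where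
  "gap v w = (\<Sum>s<n. v s - w s)"

lemma gap_ge: "(\<And>t. t < n \<Longrightarrow> w t \<le> v t) \<Longrightarrow> s < n \<Longrightarrow> v s - w s \<le> gap v w"
  unfolding gap_def by (rule member_le_sum) auto

text \<open>At the state of largest distance, the distance is a discounted sum of fewer than \<open>n\<close> reduced costs
  on the way to the cycle, plus the discounted distance at the cyclic state that is reached. These are
  at most \<open>n\<close> terms, and the largest distance is at least the average, whence the square of \<open>n\<close>.
  A positive term cannot come from the follower: his reduced costs with respect to the target are not
  positive, and on one of his cycles neither is the distance.\<close>
lemma costly_action_or_cycle:
  assumes pv: "answered p v" and qw: "answered q w" and pos: "0 < gap v w"
  obtains t where "t \<in> L" "gap v w / (real n)\<^sup>2 \<le> red w (p t)"
  | u where "u \<in> cycles p" "gap v w / (real n)\<^sup>2 \<le> v u - w u"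
proof -
  let ?f = "nxt p" and ?d = "\<lambda>t. v t - w t"
  note pol = answeredD(1,2)[OF pv]
  have f: "?f ` {..<n} \<subseteq> {..<n}" using pol(1) by (rule nxt_closed)
  have n: "0 < n" using pos unfolding gap_def by (cases n) auto
  define r where "r = gap v w / (real n)\<^sup>2"
  have r: "0 < r" "gap v w = real n * (real n * r)"
    unfolding r_def using pos n by (auto simp: power2_eq_square)
  have "\<exists>s<n. real n * r \<le> ?d s"
  proof (rule ccontr)
    assume "\<not> ?thesis"
    then have "gap v w < (\<Sum>s<n. real n * r)"
      unfolding gap_def using n by (intro sum_strict_mono) (auto simp: not_le)
    then show False using r by simp
  qed
  then obtain s where s: "s < n" "real n * r \<le> ?d s" by blast
  let ?u = "(?f ^^ (n - 1)) s"
  have u: "?u < n" "cyclic ?f ?u" using funpow_closed[OF f, of s] cyclic_after[OF f] s by auto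
  have d: "?d t = red w (p t) + \<gamma> * ?d (?f t)" if "t \<in> {..<n}" for t
    using value_diff[OF pol, of t w] that by simp
  have unroll: "?d s = (\<Sum>i<n - 1. \<gamma> ^ i * red w (p ((?f ^^ i) s))) + \<gamma> ^ (n - 1) * ?d ?u"
    by (rule discounted_unroll[where d = ?d, OF f _ d]) (use s in auto)
  have "(\<exists>i<n - 1. r \<le> red w (p ((?f ^^ i) s))) \<or> r \<le> ?d ?u"
  proof (rule ccontr)
    have scale: "\<gamma> ^ i * x < r" if "x < r" for x i
    proof (cases "0 \<le> x")
      case True
      have "\<gamma> ^ i * x \<le> 1 * x" using True discount by (intro mult_right_mono power_le_one) auto
      then show ?thesis using that by simp
    next
      case False
      then have "\<gamma> ^ i * x \<le> 0" using discount by (intro mult_nonneg_nonpos) auto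
      then show ?thesis using r by simp
    qed
    assume neg: "\<not> ?thesis"
    then have "(\<Sum>i<n - 1. \<gamma> ^ i * red w (p ((?f ^^ i) s))) \<le> (\<Sum>i<n - 1. r)"
      by (intro sum_mono less_imp_le scale) auto
    moreover have "\<gamma> ^ (n - 1) * ?d ?u < r" using neg by (intro scale) auto
    ultimately have "?d s < real (n - 1) * r + r" unfolding unroll by simp
    also have "\<dots> = real n * r" using n by (simp add: algebra_simps of_nat_diff)
    finally show False using s by simp
  qed
  then show ?thesis
  proof
    assume "\<exists>i<n - 1. r \<le> red w (p ((?f ^^ i) s))"
    then obtain i where i: "r \<le> red w (p ((?f ^^ i) s))" by blast
    let ?t = "(?f ^^ i) s"
    have "?t < n" using funpow_closed[OF f, of s] s by auto
    then have "?t \<in> L" using follower_red[OF qw pol(1), of ?t] i r by force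
    then show ?thesis using that(1) i unfolding r_def by blast
  next
    assume du: "r \<le> ?d ?u"
    have "?u \<in> L"
    proof (rule ccontr)
      assume notL: "?u \<notin> L"
      define X where "X = {t. t < n \<and> t \<notin> L \<and> cyclic ?f t}"
      have "?d ?u \<le> 0"
      proof (rule discounted_nonpos[where X = X and f = ?f and \<gamma> = \<gamma>])
        show "finite X" unfolding X_def by simp
        show "?f ` X \<subseteq> X"
        proof
          fix t assume "t \<in> ?f ` X"
          then obtain x where x: "t = ?f x" "x < n" "x \<notin> L" "cyclic ?f x" unfolding X_def by blast
          have "t \<notin> L" using forward'[OF pol(1) x(2,4)] x(1,3) by simp
          moreover have "cyclic ?f t" unfolding x(1) using x(4) by (rule cyclic_step)
          ultimately show "t \<in> X" unfolding X_def using x nxt_less[OF pol(1)] by simp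
        qed
        show "?u \<in> X" using u notL unfolding X_def by simp
        fix x assume "x \<in> X"
        then show "?d x \<le> \<gamma> * ?d (?f x)"
          using d[of x] follower_red[OF qw pol(1), of x] unfolding X_def by simp
      qed (use discount in auto)
      then show False using du r by simp
    qed
    then show ?thesis using that(2)[of ?u] u du unfolding cycles_def r_def by simp
  qed
qed

text \<open>A costly action keeps the distance large for as long as it is played: after the move the play is
  still no better than the target.\<close>
lemma red_le_gap:
  assumes pv: "answered p v" and le: "\<And>t. t < n \<Longrightarrow> w t \<le> v t" and s: "s < n"
  shows "red w (p s) \<le> gap v w"
proof -
  note pol = answeredD(1,2)[OF pv]
  have "0 \<le> \<gamma> * (v (dest (p s)) - w (dest (p s)))"
    using le[OF nxt_less[OF pol(1) s]] discount by simp
  then have "red w (p s) \<le> v s - w s" using value_diff[OF pol s, of w] by simp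
  also have "\<dots> \<le> gap v w" using le s by (rule gap_ge)
  finally show ?thesis .
qed

text \<open>The values on a cycle of the leader are determined by the actions on the cycle. Hence a costly
  cycle keeps the distance large for as long as it exists.\<close>
lemma value_on_cycles:
  assumes pv: "answered p v" and qw: "answered q w"
    and eq: "\<And>t. t \<in> cycles q \<Longrightarrow> p t = q t" and u: "u \<in> cycles q"
  shows "v u = w u"
proof -
  note pol = answeredD(1,2)[OF pv] and qol = answeredD(1,2)[OF qw]
  have d: "v t - w t = \<gamma> * (v (nxt q t) - w (nxt q t))" if "t \<in> cycles q" for t
    using value_diff[OF qol cycles_less[OF that], of v] eq[OF that]
      red_zero[OF pol cycles_less[OF that]] unfolding right_diff_distrib by simp
  have "v u - w u \<le> 0"
    by (rule discounted_nonpos[where d = "\<lambda>t. v t - w t",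
          OF finite_cycles cycles_closed[OF qol(1)] _ _ eq_refl[OF d] u])
      (use discount in auto)
  moreover have "w u - v u \<le> 0"
  proof (rule discounted_nonpos[where d = "\<lambda>t. w t - v t",
        OF finite_cycles cycles_closed[OF qol(1)] _ _ _ u])
    fix t assume "t \<in> cycles q"
    then show "w t - v t \<le> \<gamma> * (w (nxt q t) - v (nxt q t))"
      using d[of t] unfolding right_diff_distrib by linarith
  qed (use discount in auto)
  ultimately show ?thesis by simp
qed

text \<open>If all reduced costs on the cycle were below \<open>(1 - \<gamma>) r\<close>, their discounted sum would be
  below \<open>r\<close>.\<close>
lemma costly_cycle_action:
  assumes pv: "answered p v" and u: "u \<in> cycles p" "r \<le> v u - w u"
  obtains t where "t \<in> cycles p" "(1 - \<gamma>) * r \<le> red w (p t)"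
proof -
  note pol = answeredD(1,2)[OF pv]
  let ?e = "\<lambda>t. v t - w t - r"
  have "\<exists>t\<in>cycles p. (1 - \<gamma>) * r \<le> red w (p t)"
  proof (rule ccontr)
    assume neg: "\<not> ?thesis"
    have less: "?e t < \<gamma> * ?e (nxt p t)" if "t \<in> cycles p" for t
    proof -
      have "red w (p t) < (1 - \<gamma>) * r" using neg that by (simp add: not_le)
      then show ?thesis
        using value_diff[OF pol cycles_less[OF that], of w]
        unfolding right_diff_distrib left_diff_distrib by linarith
    qed
    have le: "?e t \<le> 0" if "t \<in> cycles p" for t
      by (rule discounted_nonpos[where d = ?e,
            OF finite_cycles cycles_closed[OF pol(1)] _ _ less_imp_le[OF less] that])
        (use discount in auto)
    have "nxt p u \<in> cycles p" using cycles_closed[OF pol(1)] u(1) by blast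
    then have "\<gamma> * ?e (nxt p u) \<le> 0"
      using le discount by (intro mult_nonneg_nonpos) auto
    then have "?e u < 0" using less[OF u(1)] by linarith
    then show False using u(2) by linarith
  qed
  then show ?thesis using that by blast
qed

text \<open>On a cycle the reduced cost is paid again in every round, whatever the cycle is; this makes up for the
  factor \<open>1 - \<gamma>\<close> that is lost in passing from a costly cycle to one of its actions. The optimality of the
  target excludes that other actions on the cycle compensate for the cost.\<close>
lemma red_on_cycles_le_gap:
  assumes pv: "answered p v" and le: "\<And>t. t < n \<Longrightarrow> w t \<le> v t"
    and opt: "\<And>t a. t \<in> L \<Longrightarrow> a \<in> A t \<Longrightarrow> 0 \<le> red w a" and u: "u \<in> cycles p"
  shows "red w (p u) \<le> (1 - \<gamma>) * gap v w"
proof -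
  note pol = answeredD(1,2)[OF pv]
  have "0 \<le> red w (p t)" if "t \<in> cycles p" for t
    by (rule opt[OF cycles_leader[OF that] policyD[OF pol(1) cycles_less[OF that]]])
  then have "red w (p u) \<le> (\<Sum>t\<in>cycles p. red w (p t))"
    using u finite_cycles by (intro member_le_sum) auto
  also have "\<dots> = (1 - \<gamma>) * (\<Sum>t\<in>cycles p. v t - w t)"
    by (rule discounted_sum_cyclic[where f = "nxt p", symmetric])
      (rule finite_cycles cycles_closed[OF pol(1)] cycles_cyclic value_diff[OF pol cycles_less] | assumption)+
  also have "\<dots> \<le> (1 - \<gamma>) * gap v w"
    unfolding gap_def using le cycles_less discount
    by (intro mult_left_mono sum_mono2) auto
  finally show ?thesis .
qed


section \<open>The length of a run\<close>

lemma gap_diff: "gap v w = gap v v' + gap v' w"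
  unfolding gap_def by (simp add: sum.distrib[symmetric])

text \<open>The hypothesis says that the leader's cycles in the target exist already in \<open>p\<close>. The distance is then at
  most \<open>n D\<close> at every state, and the state of the entering action alone gains at least \<open>D\<close>.\<close>
lemma pivot_shrinks_gap:
  assumes piv: "pivot (p, v) (p', v')" and qw: "answered q w"
    and cycles: "\<And>t. t \<in> cycles q \<Longrightarrow> p t = q t"
  shows "gap v' w \<le> (1 - 1 / (real n)\<^sup>2) * gap v w"
proof -
  obtain s where s: "answered p v" "answered p' v'" "s \<in> L" "red v (p' s) < 0"
    "\<And>t a. t \<in> L \<Longrightarrow> a \<in> A t \<Longrightarrow> red v (p' s) \<le> red v a"
    using piv by (elim pivotE) blast
  let ?D = "- red v (p' s)"
  have sn: "s < n" using L_less[OF s(3)] .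
  have "v t - w t \<le> real n * ?D" if "t < n" for t
    using s(4,5) by (intro gap_le_of_cycles[OF s(1) qw that cycles]) auto
  then have "gap v w \<le> (\<Sum>t<n. real n * ?D)"
    unfolding gap_def by (intro sum_mono) auto
  then have "gap v w \<le> (real n)\<^sup>2 * ?D" by (simp add: power2_eq_square)
  then have "gap v w / (real n)\<^sup>2 \<le> ?D" using sn by (simp add: field_simps)
  also have "\<dots> \<le> v s - v' s" using pivot_gain[OF piv sn] by simp
  also have "\<dots> \<le> gap v v'" using pivot_mono[OF piv] sn by (rule gap_ge)
  finally show ?thesis using gap_diff[of v w v'] by (simp add: left_diff_distrib)
qed

text \<open>Since a pivot changes only one action of the leader, this says, for pivots, that the entering action lies on a
  cycle of the new policy.\<close>
definition closes_cycle :: "(nat \<Rightarrow> nat) \<Rightarrow> (nat \<Rightarrow> nat) \<Rightarrow> bool" where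
  "closes_cycle p p' \<longleftrightarrow> (\<exists>s\<in>cycles p'. p' s \<noteq> p s)"

lemma pivot_shrinks_gap_on_cycle:
  assumes piv: "pivot (p, v) (p', v')" and qw: "answered q w" and cl: "closes_cycle p p'"
  shows "gap v' w \<le> (1 - 1 / real n) * gap v w"
proof -
  obtain s where s: "answered p v" "answered p' v'" "s \<in> L" "red v (p' s) < 0"
    "\<And>t a. t \<in> L \<Longrightarrow> a \<in> A t \<Longrightarrow> red v (p' s) \<le> red v a"
    "\<And>t. t \<in> L \<Longrightarrow> t \<noteq> s \<Longrightarrow> p' t = p t"
    using piv by (elim pivotE) blast
  note p' = answeredD(1,2)[OF s(2)]
  let ?D = "- red v (p' s)"
  have sn: "s < n" using L_less[OF s(3)] .
  have s_cycles: "s \<in> cycles p'"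
    using cl s(6) cycles_leader unfolding closes_cycle_def by metis
  have "(1 - \<gamma>) * (v t - w t) \<le> ?D" if "t < n" for t
    using s(4,5) by (intro gap_le[OF s(1) qw that]) auto
  then have "(\<Sum>t<n. (1 - \<gamma>) * (v t - w t)) \<le> (\<Sum>t<n. ?D)" by (intro sum_mono) auto
  then have "(1 - \<gamma>) * gap v w \<le> real n * ?D"
    unfolding gap_def by (simp add: sum_distrib_left)
  moreover have "?D \<le> (1 - \<gamma>) * gap v v'"
  proof -
    have "red v (p' t) = 0" if "t \<in> cycles p'" "t \<noteq> s" for t
      using red_zero[OF answeredD(1,2)[OF s(1)] cycles_less[OF that(1)]] s(6) that cycles_leader by simp
    then have "?D = (\<Sum>t\<in>cycles p'. - red v (p' t))"
      using s_cycles finite_cycles by (subst sum.remove[of _ s]) auto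
    also have "\<dots> = (1 - \<gamma>) * (\<Sum>t\<in>cycles p'. v t - v' t)"
    proof (rule discounted_sum_cyclic[symmetric, where f = "nxt p'"])
      fix x assume x: "x \<in> cycles p'"
      show "v x - v' x = - red v (p' x) + \<gamma> * (v (nxt p' x) - v' (nxt p' x))"
        using value_diff[OF p' cycles_less[OF x], of v] unfolding right_diff_distrib by simp
    qed (simp_all add: finite_cycles cycles_closed[OF p'(1)] cycles_cyclic)
    also have "\<dots> \<le> (1 - \<gamma>) * gap v v'"
      unfolding gap_def using pivot_mono[OF piv] cycles_less discount
      by (intro mult_left_mono sum_mono2) auto
    finally show ?thesis .
  qed
  ultimately have "(1 - \<gamma>) * gap v w \<le> (1 - \<gamma>) * (real n * gap v v')"
    using mult_left_mono[of ?D "(1 - \<gamma>) * gap v v'" "real n"] by (simp add: algebra_simps)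
  then have "gap v w \<le> real n * gap v v'" using discount by simp
  then have "gap v w / real n \<le> gap v v'" using sn by (simp add: field_simps)
  then show ?thesis using gap_diff[of v w v'] by (simp add: left_diff_distrib)
qed

text \<open>Every other leader strategy pays reduced costs that are not negative, and the follower's best response
  to it is at least as good for him as his strategy in the target.\<close>
lemma optimal_le:
  assumes qw: "answered q w" and opt: "\<And>t a. t \<in> L \<Longrightarrow> a \<in> A t \<Longrightarrow> 0 \<le> red w a"
    and pv: "answered p v" and s: "s < n"
  shows "w s \<le> v s"
proof -
  have "w s - v s \<le> 0"
  proof (rule discounted_nonpos[where X = "{..<n}" and f = "nxt (mix q p)" and \<gamma> = \<gamma>])
    show "nxt (mix q p) ` {..<n} \<subseteq> {..<n}"
      by (intro nxt_closed policy_mix answeredD(1)[OF qw] answeredD(1)[OF pv])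
    fix x assume x: "x \<in> {..<n}"
    have "0 \<le> red w (p x)" if "x \<in> L"
      using opt[OF that] policyD[OF answeredD(1)[OF pv]] x by simp
    then show "w x - v x \<le> \<gamma> * (w (nxt (mix q p) x) - v (nxt (mix q p) x))"
      using gap_recursion[OF qw pv, of x] x by (auto split: if_splits)
  qed (use s discount in auto)
  then show ?thesis by simp
qed

text \<open>The numbers of pivots, of either kind, after which the distance has lost a factor of more than \<open>n\<^sup>2\<close>.
  Adding 1 to the integer part makes the inequalities strict, also for \<open>n = 1\<close>.\<close>
definition path_block :: nat where
  "path_block = nat \<lfloor>2 * (real n)\<^sup>2 * ln (real n)\<rfloor> + 1"

definition cycle_block :: nat where
  "cycle_block = nat \<lfloor>2 * real n * ln (real n)\<rfloor> + 1"

lemma path_block: "2 * (real n)\<^sup>2 * ln (real n) < real path_block"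
  unfolding path_block_def by linarith

lemma cycle_block: "2 * real n * ln (real n) < real cycle_block"
  unfolding cycle_block_def by linarith

lemma pivot_answered: "pivot x y \<Longrightarrow> answered (fst x) (snd x)" "pivot x y \<Longrightarrow> answered (fst y) (snd y)"
  by (cases x; cases y; simp)+

lemma action_loc:
  "policy p \<Longrightarrow> policy p' \<Longrightarrow> s < n \<Longrightarrow> t < n \<Longrightarrow> p s = p' t \<Longrightarrow> s = t"
  using A_loc policyD by metis

lemma gap_pos:
  assumes "pivot (p, v) (p', v')" "\<And>t. t < n \<Longrightarrow> w t \<le> v' t"
  shows "0 < gap v w"
proof -
  obtain s where s: "s \<in> L" "red v (p' s) < 0" using assms(1) by (elim pivotE) blast
  have sn: "s < n" using L_less[OF s(1)] .
  have "w s < v s" using pivot_gain[OF assms(1) sn] s(2) assms(2)[OF sn] by simp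
  moreover have "v s - w s \<le> gap v w"
    using assms(2) pivot_mono[OF assms(1)] order_trans sn by (intro gap_ge) blast+
  ultimately show ?thesis by simp
qed

lemma gap_nonneg: "(\<And>t. t < n \<Longrightarrow> w t \<le> v t) \<Longrightarrow> 0 \<le> gap v w"
  unfolding gap_def by (intro sum_nonneg) auto

lemma run_answered:
  assumes run: "\<And>i. i < T \<Longrightarrow> pivot (P i, V i) (P (Suc i), V (Suc i))" and "0 < T" "i \<le> T"
  shows "answered (P i) (V i)"
proof (cases i)
  case 0
  then show ?thesis using pivot_answered(1)[OF run[OF assms(2)]] by simp
next
  case (Suc k)
  then show ?thesis using pivot_answered(2)[OF run[of k]] assms(3) by simp
qed

lemma run_mono:
  assumes run: "\<And>i. i < T \<Longrightarrow> pivot (P i, V i) (P (Suc i), V (Suc i))"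
    and "i \<le> l" "l \<le> T" "t < n"
  shows "V l t \<le> V i t"
  using assms(2,3)
proof (induction rule: dec_induct)
  case (step k)
  have "V (Suc k) t \<le> V k t" using step(2) step.prems by (intro pivot_mono[OF run assms(4)]) simp
  then show ?case using step by simp
qed simp

lemma cycles_within_phase:
  assumes run: "\<And>i. i < T \<Longrightarrow> pivot (P i, V i) (P (Suc i), V (Suc i))"
    and no: "\<And>i. i < T \<Longrightarrow> \<not> closes_cycle (P i) (P (Suc i))"
    and "i \<le> l" "l \<le> T" "t \<in> cycles (P l)"
  shows "t \<in> cycles (P i) \<and> P i t = P l t"
  using assms(3-5)
proof (induction arbitrary: t rule: dec_induct)
  case (step k)
  have k: "k < T" using step.prems by simp
  have eq: "P k s = P (Suc k) s" if "s \<in> cycles (P (Suc k))" for s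
    using no[OF k] that unfolding closes_cycle_def by metis
  have "policy (P (Suc k))"
    using pivot_answered(2)[OF run[OF k]] answeredD(1) by simp
  then have "cycles (P (Suc k)) \<subseteq> cycles (P k)" using eq by (rule cycles_subset)
  then show ?case using step eq by (metis Suc_leD subsetD)
qed simp

text \<open>The target is the last policy \<open>P T\<close> of the phase. The tokens are the actions of the leader and her cyclic
  states: after a block of pivots the distance is too small for the costly action, or the costly cycle, of
  the policy at the beginning of the block.\<close>
lemma phase_length:
  assumes run: "\<And>i. i < T \<Longrightarrow> pivot (P i, V i) (P (Suc i), V (Suc i))"
    and no: "\<And>i. i < T \<Longrightarrow> \<not> closes_cycle (P i) (P (Suc i))"
  shows "T < path_block * (m + n + 1)"
proof (cases "T = 0")
  case True
  then show ?thesis by (simp add: path_block_def)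
next
  case False
  then have T: "0 < T" by simp
  have ans: "answered (P i) (V i)" if "i \<le> T" for i
    by (rule run_answered[OF _ T that]) (rule run)
  note pol = answeredD(1)[OF ans]
  have mono: "V l t \<le> V i t" if "i \<le> l" "l \<le> T" "t < n" for i l t
    by (rule run_mono[OF _ that]) (rule run)
  have same: "t \<in> cycles (P i) \<and> P i t = P l t" if "i \<le> l" "l \<le> T" "t \<in> cycles (P l)" for i l t
    by (rule cycles_within_phase[where P = P and V = V and T = T]) (rule run no that; assumption?)+
  let ?w = "V T"
  define G where "G l = gap (V l) ?w" for l
  define tok where "tok l = Inl ` P l ` L \<union> (Inr ` cycles (P l) :: (nat + nat) set)" for l
  have n: "0 < n" using run[OF T] L_less by fastforce
  have G_nonneg: "0 \<le> G l" if "l \<le> T" for l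
    unfolding G_def using mono that by (intro gap_nonneg) auto
  have dec: "G (Suc l) \<le> (1 - 1 / (real n)\<^sup>2) * G l" if "l < T" for l
    unfolding G_def
    by (rule pivot_shrinks_gap[OF run[OF that] ans]) (use that same[of l T] in auto)
  have decay: "G l < G i / (real n)\<^sup>2" if il: "i + path_block \<le> l" "l \<le> T" for i l
  proof -
    have n2: "1 \<le> (real n)\<^sup>2" using n by simp
    have le: "G l \<le> (1 - 1 / (real n)\<^sup>2) ^ (l - i) * G i"
    proof (rule decay_along[where h = "\<lambda>l. l"])
      show "0 \<le> 1 - 1 / (real n)\<^sup>2" using n2 by (simp add: divide_le_eq)
      fix l' assume l': "l' < l"
      have "G (Suc l') \<le> (1 - 1 / (real n)\<^sup>2) * G l'" using dec l' il by simp
      also have "\<dots> \<le> G l'"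
        using G_nonneg[of l'] l' il n2 by (intro mult_left_le_one_le) (auto simp: divide_le_eq)
      finally show "G (Suc l') \<le> G l'" .
    qed (use il dec G_nonneg in auto)
    have less: "(1 - 1 / (real n)\<^sup>2) ^ (l - i) < 1 / (real n)\<^sup>2"
      using n n2 path_block il by (intro geometric_decay) auto
    have "0 < G i"
      unfolding G_def using il T mono by (intro gap_pos[OF run]) (auto simp: path_block_def)
    then show ?thesis using le mult_strict_right_mono[OF less] by fastforce
  qed
  have "T < path_block * ((m + n) + 1)"
  proof (rule length_less_by_elimination[where h = "\<lambda>l. l" and tok = tok
        and X = "Inl ` {..<m} \<union> Inr ` {..<n}"])
    show "card (Inl ` {..<m} \<union> Inr ` {..<n} :: (nat + nat) set) \<le> m + n"
      by (rule order_trans[OF card_Un_le]) (simp add: card_image)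
    show "tok l \<subseteq> Inl ` {..<m} \<union> Inr ` {..<n}" if "l \<le> T" for l
      unfolding tok_def using A_bounded[OF L_less policyD[OF pol[OF that] L_less]] cycles_less by auto
    fix i assume i: "i \<le> T" "i + path_block \<le> T"
    have pos: "0 < gap (V i) ?w"
      using i T mono by (intro gap_pos[OF run]) (auto simp: path_block_def)
    show "\<exists>x\<in>tok i. \<forall>l\<le>T. i + path_block \<le> l \<longrightarrow> x \<notin> tok l"
      using costly_action_or_cycle[OF ans[OF i(1)] ans[OF order_refl] pos]
    proof cases
      case (1 t)
      have "Inl (P i t) \<notin> tok l" if l: "l \<le> T" "i + path_block \<le> l" for l
      proof
        assume "Inl (P i t) \<in> tok l"
        then obtain t' where "t' \<in> L" "P i t = P l t'" unfolding tok_def by auto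
        then have "P i t = P l t"
          using action_loc[OF pol[OF i(1)] pol[OF l(1)] L_less[OF 1(1)] L_less] by simp
        then have "red ?w (P i t) \<le> G l"
          unfolding G_def using red_le_gap[OF ans[OF l(1)] mono L_less[OF 1(1)]] l(1) by simp
        then show False using decay[OF l(2,1)] 1(2) unfolding G_def by simp
      qed
      then show ?thesis using 1(1) unfolding tok_def by blast
    next
      case (2 u)
      have "Inr u \<notin> tok l" if l: "l \<le> T" "i + path_block \<le> l" for l
      proof
        assume "Inr u \<in> tok l"
        then have u: "u \<in> cycles (P l)" unfolding tok_def by auto
        have "V i u = V l u"
          by (rule value_on_cycles[OF ans[OF i(1)] ans[OF l(1)] _ u])
            (use same[of i l] l in auto)
        moreover have "V l u - ?w u \<le> G l"
          unfolding G_def using mono l(1) cycles_less[OF u] by (intro gap_ge) auto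
        ultimately show False using decay[OF l(2,1)] 2(2) unfolding G_def by simp
      qed
      then show ?thesis using 2(1) unfolding tok_def by blast
    qed
  qed (auto simp: path_block_def)
  then show ?thesis by (simp add: add.assoc)
qed

text \<open>The target is optimal, the clock counts closing pivots, and the tokens are the actions used by the leader
  (\<open>Inl\<close>) and those that she uses on a cycle (\<open>Inr\<close>). A costly cycle eliminates one of its
  actions from all cycles, not only from this one, because the target is optimal.\<close>
lemma number_of_closing_pivots:
  assumes run: "\<And>i. i < T \<Longrightarrow> pivot (P i, V i) (P (Suc i), V (Suc i))"
    and qw: "answered q w" and opt: "\<And>t a. t \<in> L \<Longrightarrow> a \<in> A t \<Longrightarrow> 0 \<le> red w a"
  shows "card {i. i < T \<and> closes_cycle (P i) (P (Suc i))} < cycle_block * (2 * m + 1)"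
proof (cases "T = 0")
  case True
  then show ?thesis by (simp add: cycle_block_def)
next
  case False
  then have T: "0 < T" by simp
  have ans: "answered (P i) (V i)" if "i \<le> T" for i
    by (rule run_answered[OF _ T that]) (rule run)
  note pol = answeredD(1)[OF ans]
  have mono: "V l t \<le> V i t" if "i \<le> l" "l \<le> T" "t < n" for i l t
    by (rule run_mono[OF _ that]) (rule run)
  define E where "E = {i. i < T \<and> closes_cycle (P i) (P (Suc i))}"
  define h where "h l = card (E \<inter> {..<l})" for l
  have h_Suc: "h (Suc l) = (if l \<in> E then Suc (h l) else h l)" for l
    unfolding h_def by (simp add: lessThan_Suc)
  have h_mono: "h i \<le> h j" if "i \<le> j" for i j
    using lift_Suc_mono_le[of h, OF _ that] by (simp add: h_Suc)
  have hT: "h T = card E" unfolding h_def E_def by (rule arg_cong[of _ _ card]) auto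
  define G where "G l = gap (V l) w" for l
  define tok where "tok l = Inl ` P l ` L \<union> (Inr ` P l ` cycles (P l) :: (nat + nat) set)" for l
  have n: "0 < n" using run[OF T] L_less by fastforce
  have le: "w t \<le> V l t" if "l \<le> T" "t < n" for l t
    by (rule optimal_le[OF qw _ ans[OF that(1)] that(2)]) (rule opt)
  have G_nonneg: "0 \<le> G l" if "l \<le> T" for l
    unfolding G_def using le that by (intro gap_nonneg) auto
  have dec: "G (Suc l) \<le> (1 - 1 / real n) * G l" if "l \<in> E" for l
    unfolding G_def using that unfolding E_def
    by (intro pivot_shrinks_gap_on_cycle[OF run qw]) auto
  have dec': "G (Suc l) \<le> G l" if "l < T" for l
    unfolding G_def gap_def using pivot_mono[OF run[OF that]] by (intro sum_mono) auto
  have pos: "0 < G i" if "h i < h T" "i \<le> T" for i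
  proof -
    have "i < T" using that by (cases "i = T") auto
    then show ?thesis unfolding G_def using le by (intro gap_pos[OF run]) auto
  qed
  have decay: "G l < G i / (real n)\<^sup>2" if il: "h i + cycle_block \<le> h l" "l \<le> T" for i l
  proof -
    have hl: "h i < h l" using il(1) by (simp add: cycle_block_def)
    then have ij: "i \<le> l" using h_mono[of l i] by (cases "i \<le> l") auto
    have le: "G l \<le> (1 - 1 / real n) ^ (h l - h i) * G i"
      by (rule decay_along) (use il ij n dec dec' G_nonneg in \<open>auto simp: h_Suc split: if_splits\<close>)
    have less: "(1 - 1 / real n) ^ (h l - h i) < 1 / (real n)\<^sup>2"
      using n cycle_block il by (intro geometric_decay) auto
    have "0 < G i" using pos[of i] hl ij il h_mono[of l T] by simp
    then show ?thesis using le mult_strict_right_mono[OF less] by fastforce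
  qed
  have "h T < cycle_block * ((2 * m) + 1)"
  proof (rule length_less_by_elimination[where h = h and tok = tok
        and X = "Inl ` {..<m} \<union> Inr ` {..<m}"])
    show "card (Inl ` {..<m} \<union> Inr ` {..<m} :: (nat + nat) set) \<le> 2 * m"
      by (rule order_trans[OF card_Un_le]) (simp add: card_image)
    show "tok l \<subseteq> Inl ` {..<m} \<union> Inr ` {..<m}" if "l \<le> T" for l
      unfolding tok_def
      using A_bounded[OF L_less policyD[OF pol[OF that] L_less]] cycles_leader by auto
    fix i assume i: "i \<le> T" "h i + cycle_block \<le> h T"
    have "h i < h T" using i(2) by (simp add: cycle_block_def)
    then have "0 < gap (V i) w" using pos i(1) unfolding G_def by blast
    with ans[OF i(1)] qw show "\<exists>x\<in>tok i. \<forall>l\<le>T. h i + cycle_block \<le> h l \<longrightarrow> x \<notin> tok l"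
    proof (cases rule: costly_action_or_cycle)
      case (1 t)
      have "Inl (P i t) \<notin> tok l" if l: "l \<le> T" "h i + cycle_block \<le> h l" for l
      proof
        assume "Inl (P i t) \<in> tok l"
        then obtain t' where "t' \<in> L" "P i t = P l t'" unfolding tok_def by auto
        then have "P i t = P l t"
          using action_loc[OF pol[OF i(1)] pol[OF l(1)] L_less[OF 1(1)] L_less] by simp
        then have "red w (P i t) \<le> G l"
          unfolding G_def using red_le_gap[OF ans[OF l(1)] le[OF l(1)] L_less[OF 1(1)]] by simp
        then show False using decay[OF l(2,1)] 1(2) unfolding G_def by simp
      qed
      then show ?thesis using 1(1) unfolding tok_def by blast
    next
      case (2 u)
      obtain t where t: "t \<in> cycles (P i)" "(1 - \<gamma>) * (gap (V i) w / (real n)\<^sup>2) \<le> red w (P i t)"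
        using costly_cycle_action[where w = w, OF ans[OF i(1)] 2] by blast
      have "Inr (P i t) \<notin> tok l" if l: "l \<le> T" "h i + cycle_block \<le> h l" for l
      proof
        assume "Inr (P i t) \<in> tok l"
        then obtain t' where t': "t' \<in> cycles (P l)" "P i t = P l t'" unfolding tok_def by auto
        then have "red w (P i t) \<le> (1 - \<gamma>) * G l"
          unfolding G_def using red_on_cycles_le_gap[OF ans[OF l(1)] le[OF l(1)] opt] by simp
        also have "\<dots> < (1 - \<gamma>) * (G i / (real n)\<^sup>2)"
          using decay[OF l(2,1)] discount by (intro mult_strict_left_mono) auto
        finally show False using t(2) unfolding G_def by simp
      qed
      then show ?thesis using t(1) unfolding tok_def by blast
    qed
  qed (auto simp: cycle_block_def h_Suc, auto simp: h_def)
  then show ?thesis unfolding hT E_def by simp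
qed

section \<open>Best responses and optimal profiles exist\<close>

lemma value_exists:
  assumes "policy p"
  shows "\<exists>v. value_of p v"
proof -
  obtain v where "\<And>s. s \<in> {..<n} \<Longrightarrow> v s = c (p s) + \<gamma> * v (nxt p s)"
    using discounted_solution[of "{..<n}" "nxt p" \<gamma> "\<lambda>s. c (p s)"] nxt_closed[OF assms] discount
    by auto
  then show ?thesis unfolding value_of_def by auto
qed

lemma value_unique:
  assumes "policy p" "value_of p v" "value_of p v'" "s < n"
  shows "v s = v' s"
proof -
  have "v' s \<le> v s + red v (p s)" "v s + red v (p s) \<le> v' s"
    using value_gain_of_red[OF assms(1,3), of v s] value_loss_of_red[OF assms(1,3), of v s]
      red_zero[OF assms(1,2)] assms(4) by simp_all
  then show ?thesis using red_zero[OF assms(1,2,4)] by simp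
qed

text \<open>Only the restriction of a policy to the states matters, and there are finitely many such restrictions.
  Thus best responses and optimal policies can be found as extremal ones.\<close>
lemma finite_value_sums: "finite {\<Sum>s<n. v s | p v. policy p \<and> value_of p v}"
proof -
  define W where "W p = (SOME v. value_of p v)" for p
  have W: "value_of p (W p)" if "policy p" for p
    unfolding W_def using value_exists[OF that] by (rule someI_ex)
  have "{\<Sum>s<n. v s | p v. policy p \<and> value_of p v}
      \<subseteq> (\<lambda>p. \<Sum>s<n. W p s) ` (\<Pi>\<^sub>E s\<in>{..<n}. A s)"
  proof
    fix x assume "x \<in> {\<Sum>s<n. v s | p v. policy p \<and> value_of p v}"
    then obtain p v where p: "x = (\<Sum>s<n. v s)" "policy p" "value_of p v" by blast
    let ?p = "restrict p {..<n}"
    have p': "policy ?p" "value_of ?p v" using p unfolding policy_def value_of_def by auto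
    then have "x = (\<Sum>s<n. W ?p s)"
      unfolding p(1) using value_unique[OF p'(1,2) W[OF p'(1)]] by (intro sum.cong) auto
    moreover have "?p \<in> (\<Pi>\<^sub>E s\<in>{..<n}. A s)" using p(2) unfolding policy_def by auto
    ultimately show "x \<in> (\<lambda>p. \<Sum>s<n. W p s) ` (\<Pi>\<^sub>E s\<in>{..<n}. A s)" by blast
  qed
  moreover have "finite (A s)" if "s < n" for s
    by (rule finite_subset[OF _ finite_lessThan[of m]]) (use A_bounded[OF that] in auto)
  then have "finite ((\<lambda>p. \<Sum>s<n. W p s) ` (\<Pi>\<^sub>E s\<in>{..<n}. A s))" by (intro finite_imageI finite_PiE) auto
  ultimately show ?thesis by (rule finite_subset)
qed

text \<open>Among the policies that agree with \<open>q\<close> on the leader's states, take one with the largest sum of values: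
  a profitable switch of the follower would increase it.\<close>
lemma best_response_exists:
  assumes q: "policy q"
  shows "\<exists>p v. answered p v \<and> (\<forall>s\<in>L. p s = q s)"
proof -
  define R where "R p v \<longleftrightarrow> policy p \<and> value_of p v \<and> (\<forall>s\<in>L. p s = q s)" for p v
  define Z where "Z = {\<Sum>s<n. v s | p v. R p v}"
  have finZ: "finite Z"
    by (rule finite_subset[OF _ finite_value_sums]) (auto simp: Z_def R_def)
  have "Z \<noteq> {}" using value_exists[OF q] q unfolding Z_def R_def by blast
  then have "Max Z \<in> Z" using finZ by simp
  then obtain p v where pv: "R p v" "Max Z = (\<Sum>s<n. v s)" unfolding Z_def by blast
  have p: "policy p" "value_of p v" using pv(1) unfolding R_def by auto
  have "red v a \<le> 0" if s: "s < n" "s \<notin> L" "a \<in> A s" for s a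
  proof (rule ccontr)
    assume neg: "\<not> red v a \<le> 0"
    let ?p = "p(s := a)"
    have p': "policy ?p" using p(1) s unfolding policy_def by simp
    obtain v' where v': "value_of ?p v'" using value_exists[OF p'] by blast
    have red: "0 \<le> red v (?p t)" if "t < n" for t
      using neg red_zero[OF p that] by simp
    note loss = value_loss_of_red[OF p' v' red]
    have "(\<Sum>t<n. v t) < (\<Sum>t<n. v' t)"
    proof (rule sum_strict_mono_ex1)
      show "\<forall>t\<in>{..<n}. v t \<le> v' t"
      proof
        fix t assume "t \<in> {..<n}"
        then show "v t \<le> v' t" using loss[of t] red[of t] by simp
      qed
      show "\<exists>t\<in>{..<n}. v t < v' t" using loss[of s] neg s(1) by (intro bexI[of _ s]) auto
    qed simp
    moreover have "R ?p v'" using pv(1) p' v' s(2) unfolding R_def by auto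
    then have "(\<Sum>t<n. v' t) \<in> Z" unfolding Z_def by blast
    then have "(\<Sum>t<n. v' t) \<le> Max Z" using finZ by simp
    ultimately show False using pv(2) by simp
  qed
  then have "answered p v" using p unfolding answered_def by auto
  then show ?thesis using pv(1) unfolding R_def by blast
qed

text \<open>Among the answered policies take one with the least sum of values: a switch of the leader to an action of
  negative reduced cost, followed by a best response, would decrease it.\<close>
lemma optimal_exists:
  "\<exists>q w. answered q w \<and> (\<forall>t\<in>L. \<forall>a\<in>A t. 0 \<le> red w a)"
proof -
  define Z where "Z = {\<Sum>s<n. v s | p v. answered p v}"
  have finZ: "finite Z"
    by (rule finite_subset[OF _ finite_value_sums]) (auto simp: Z_def answered_def)
  have "policy (\<lambda>s. SOME a. a \<in> A s)"
    unfolding policy_def using A_nonempty by (simp add: some_in_eq)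
  then obtain p v where "answered p v" using best_response_exists by blast
  then have "Z \<noteq> {}" unfolding Z_def by blast
  then have "Min Z \<in> Z" using finZ by simp
  then obtain q w where qw: "answered q w" "Min Z = (\<Sum>s<n. w s)" unfolding Z_def by blast
  note q = answeredD(1,2)[OF qw(1)]
  have "0 \<le> red w a" if t: "t \<in> L" "a \<in> A t" for t a
  proof (rule ccontr)
    assume neg: "\<not> 0 \<le> red w a"
    have tn: "t < n" using L_less[OF t(1)] .
    have "policy (q(t := a))" using q(1) t(2) unfolding policy_def by simp
    then obtain p v where pv: "answered p v" "\<forall>s\<in>L. p s = (q(t := a)) s"
      using best_response_exists by blast
    note p = answeredD(1,2)[OF pv(1)]
    have red: "red w (p s) \<le> 0" if "s < n" for s
    proof (cases "s \<in> L")
      case True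
      then show ?thesis using bspec[OF pv(2) True] neg red_zero[OF q that] by (cases "s = t") auto
    next
      case False
      then show ?thesis using follower_red[OF qw(1) p(1) that] by simp
    qed
    note gain = value_gain_of_red[OF p red]
    have "(\<Sum>s<n. v s) < (\<Sum>s<n. w s)"
    proof (rule sum_strict_mono_ex1)
      show "\<forall>s\<in>{..<n}. v s \<le> w s"
      proof
        fix s assume "s \<in> {..<n}"
        then show "v s \<le> w s" using gain[of s] red[of s] by simp
      qed
      show "\<exists>s\<in>{..<n}. v s < w s"
        using gain[of t] neg tn bspec[OF pv(2) t(1)] by (intro bexI[of _ t]) auto
    qed simp
    moreover have "(\<Sum>s<n. v s) \<in> Z" unfolding Z_def using pv(1) by blast
    then have "Min Z \<le> (\<Sum>s<n. v s)" using finZ by simp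
    ultimately show False using qw(2) by simp
  qed
  then show ?thesis using qw(1) by blast
qed

definition max_run :: nat where
  "max_run = cycle_block * (2 * m + 1) * (path_block * (m + n + 1))"

theorem run_length:
  assumes "(pivot ^^ T) x y"
  shows "T < max_run"
proof -
  obtain f where f: "\<And>i. i < T \<Longrightarrow> pivot (f i) (f (Suc i))"
    using assms unfolding relpowp_fun_conv by blast
  define P V where "P i = fst (f i)" and "V i = snd (f i)" for i
  have run: "pivot (P i, V i) (P (Suc i), V (Suc i))" if "i < T" for i
    using f[OF that] unfolding P_def V_def by simp
  obtain q w where opt: "answered q w" "\<forall>t\<in>L. \<forall>a\<in>A t. 0 \<le> red w a"
    using optimal_exists by blast
  let ?E = "{i. i < T \<and> closes_cycle (P i) (P (Suc i))}"
  have phases: "T < (card ?E + 1) * (path_block * (m + n + 1))"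
  proof (rule length_less_by_phases)
    fix i j assume ij: "i \<le> j" "j \<le> T" "{i..<j} \<inter> ?E = {}"
    show "j - i < path_block * (m + n + 1)"
    proof (rule phase_length[where P = "\<lambda>k. P (i + k)" and V = "\<lambda>k. V (i + k)"])
      fix k assume k: "k < j - i"
      then show "pivot (P (i + k), V (i + k)) (P (i + Suc k), V (i + Suc k))"
        using run[of "i + k"] ij by simp
      have "i + k \<in> {i..<j}" "i + k < T" using k ij by auto
      then show "\<not> closes_cycle (P (i + k)) (P (i + Suc k))" using ij(3) by fastforce
    qed
  qed auto
  have "card ?E < cycle_block * (2 * m + 1)"
    by (rule number_of_closing_pivots[where P = P and V = V, OF run opt(1)]) (use opt(2) in auto)
  then have "(card ?E + 1) * (path_block * (m + n + 1)) \<le> max_run"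
    unfolding max_run_def by (intro mult_right_mono) simp_all
  with phases show ?thesis by (rule less_le_trans)
qed

end

section \<open>The two players of a forward game as leaders\<close>

lemma (in pre_digraph) cas_orbit:
  assumes "\<And>i. i < k \<Longrightarrow> tail G (p ((f ^^ i) s)) = (f ^^ i) s"
    "\<And>i. i < k \<Longrightarrow> head G (p ((f ^^ i) s)) = (f ^^ Suc i) s"
  shows "cas s (map (\<lambda>i. p ((f ^^ i) s)) [0..<k]) ((f ^^ k) s)"
  using assms
proof (induction k arbitrary: s)
  case (Suc k)
  have "map (\<lambda>i. p ((f ^^ i) s)) [0..<Suc k] = p s # map (\<lambda>i. p ((f ^^ i) (f s))) [0..<k]"
    by (simp add: map_upt_Suc funpow_swap1 del: upt_Suc)
  moreover have "cas (f s) (map (\<lambda>i. p ((f ^^ i) (f s))) [0..<k]) ((f ^^ k) (f s))"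
    using Suc.prems(1)[of "Suc i" for i] Suc.prems(2)[of "Suc i" for i]
    by (intro Suc.IH) (simp_all add: funpow_swap1)
  ultimately show ?case
    using Suc.prems(1)[of 0] Suc.prems(2)[of 0] by (simp add: funpow_swap1)
qed simp

text \<open>One round with the least period is a simple cycle. If that period is 1, the two arcs are the same
  self-loop.\<close>
lemma cycle_orbit:
  assumes verts: "\<And>i. (f ^^ i) s \<in> verts H" and arcs: "\<And>i. p ((f ^^ i) s) \<in> arcs H"
    and tl: "\<And>i. tail H (p ((f ^^ i) s)) = (f ^^ i) s"
    and hd: "\<And>i. head H (p ((f ^^ i) s)) = (f ^^ Suc i) s"
    and cyc: "cyclic f s"
  obtains c where "pre_digraph.cycle H c" "p s \<in> set c" "p (f s) \<in> set c"
proof -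
  interpret pre_digraph H .
  obtain k where k: "0 < k" "(f ^^ k) s = s" and inj: "inj_on (\<lambda>i. (f ^^ Suc i) s) {0..<k}"
    using cyc by (rule cyclic_period)
  define c where "c = map (\<lambda>i. p ((f ^^ i) s)) [0..<k]"
  have cas: "cas s c s" using cas_orbit[of k p f s] tl hd k unfolding c_def by simp
  have ne: "c \<noteq> []" unfolding c_def using k by simp
  have "tl (awalk_verts s c) = map (\<lambda>i. (f ^^ Suc i) s) [0..<k]"
    using awalk_verts_conv'[OF cas] ne hd unfolding c_def by (simp add: comp_def)
  then have "distinct (tl (awalk_verts s c))" using inj by (simp add: distinct_map)
  moreover have "awalk s c s"
    unfolding awalk_def using cas verts[of 0] arcs unfolding c_def by auto
  ultimately have "cycle c" unfolding cycle_def using ne by blast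
  moreover have "p s \<in> set c" unfolding c_def using k by force
  moreover have "p (f s) \<in> set c"
  proof (cases "k = 1")
    case True
    then show ?thesis using k \<open>p s \<in> set c\<close> by simp
  next
    case False
    then have "1 \<in> {0..<k}" using k by auto
    then have "p ((f ^^ 1) s) \<in> set c" unfolding c_def by (auto simp del: funpow.simps)
    then show ?thesis by simp
  qed
  ultimately show ?thesis using that by blast
qed

locale tbdfg =
  fixes G :: tbdg
  assumes TBDFG: "TBDFG G"
begin

abbreviation n :: nat where "n \<equiv> nstates G"
abbreviation m :: nat where "m \<equiv> nactions G"

lemma TBDG: "TBDG G"
  using TBDFG unfolding TBDFG_def by simp

lemma states: "states1 G \<union> states2 G = {..<n}" "states1 G \<inter> states2 G = {}"
  using TBDG unfolding TBDG_def by auto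

lemma state_less: "s \<in> states1 G \<Longrightarrow> s < n" "s \<in> states2 G \<Longrightarrow> s < n"
  using states(1) by auto

lemma states2_iff: "s < n \<Longrightarrow> s \<in> states2 G \<longleftrightarrow> s \<notin> states1 G"
  using states by auto

lemma acts_nonempty: "s < n \<Longrightarrow> acts G s \<noteq> {}"
  using TBDG unfolding TBDG_def by auto

lemma acts: "a \<in> acts G s \<Longrightarrow> a < m" "a \<in> acts G s \<Longrightarrow> loc G a = s"
  unfolding acts_def by auto

lemma dest_less: "a < m \<Longrightarrow> dest G a < n" and loc_less: "a < m \<Longrightarrow> loc G a < n"
  using TBDG unfolding TBDG_def by auto

lemma discount: "0 < discount G" "discount G < 1"
  using TBDG unfolding TBDG_def by auto

lemma states_le_actions: "n \<le> m"
proof -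
  have "{..<n} \<subseteq> loc G ` {..<m}"
    using acts_nonempty unfolding acts_def by fastforce
  then have "card {..<n} \<le> card {..<m}" by (rule surj_card_le[rotated]) simp
  then show ?thesis by simp
qed

text \<open>If a cycle changed hands between \<open>s\<close> and the next state, the actions at these two states
  would belong to different players.\<close>
lemma cyclic_same_player:
  assumes p: "\<And>t. t < n \<Longrightarrow> p t \<in> acts G t" and s: "s < n"
    and cyc: "cyclic (\<lambda>t. dest G (p t)) s"
  shows "s \<in> states1 G \<longleftrightarrow> dest G (p s) \<in> states1 G"
proof -
  let ?f = "\<lambda>t. dest G (p t)"
  have f: "?f ` {..<n} \<subseteq> {..<n}" using p acts(1) dest_less by blast
  have in_n: "(?f ^^ i) s < n" for i using funpow_closed[OF f, of s i] s by simp
  obtain c where c: "pre_digraph.cycle (game_graph G) c" "p s \<in> set c" "p (?f s) \<in> set c"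
    by (rule cycle_orbit[of ?f s "game_graph G" p])
      (use in_n acts[OF p[OF in_n]] cyc in \<open>auto simp: game_graph_def\<close>)
  have in1: "p t \<in> acts1 G" if "t \<in> states1 G" for t
    using p[OF state_less(1)[OF that]] that unfolding acts1_def by blast
  have in2: "p t \<in> acts2 G" if "t \<in> states2 G" for t
    using p[OF state_less(2)[OF that]] that unfolding acts2_def by blast
  have "set c \<inter> acts1 G = {} \<or> set c \<inter> acts2 G = {}"
    using TBDFG c(1) unfolding TBDFG_def by blast
  moreover have "?f s < n" using in_n[of 1] by simp
  ultimately show ?thesis
    using c(2,3) in1 in2 states2_iff[OF s] states2_iff[of "?f s"] by blast
qed

sublocale one: forward_game n m "states1 G" "acts G" "loc G" "dest G" "cost G" "discount G"
proof
  show "states1 G \<subseteq> {..<n}" using states(1) by blast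
  show "s \<in> states1 G \<longleftrightarrow> dest G (p s) \<in> states1 G"
    if "\<And>t. t < n \<Longrightarrow> p t \<in> acts G t" "s < n" "cyclic (\<lambda>t. dest G (p t)) s" for p s
    using that by (rule cyclic_same_player)
qed (use acts acts_nonempty dest_less discount in auto)

text \<open>While Player 2 runs the simplex method, Player 1 is bound to \<open>\<sigma>\<close>.\<close>
definition acts_against :: "strategy \<Rightarrow> nat \<Rightarrow> nat set" where
  "acts_against \<sigma> s = (if s \<in> states2 G then acts G s else {\<sigma> s})"

lemma strategy_acts:
  "\<sigma> \<in> strategies1 G \<Longrightarrow> s \<in> states1 G \<Longrightarrow> \<sigma> s \<in> acts G s"
  "\<tau> \<in> strategies2 G \<Longrightarrow> s \<in> states2 G \<Longrightarrow> \<tau> s \<in> acts G s"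
  unfolding strategies1_def strategies2_def by auto

lemma acts_against: "\<sigma> \<in> strategies1 G \<Longrightarrow> s < n \<Longrightarrow> acts_against \<sigma> s \<subseteq> acts G s"
  unfolding acts_against_def using strategy_acts(1) states2_iff by auto

lemma two:
  assumes "\<sigma> \<in> strategies1 G"
  shows "forward_game n m (states2 G) (acts_against \<sigma>) (loc G) (dest G) (discount G)"
proof -
  note sub = subsetD[OF acts_against[OF assms]]
  show ?thesis
  proof
    show "states2 G \<subseteq> {..<n}" using states(1) by blast
    show "acts_against \<sigma> s \<noteq> {}" if "s < n" for s
      using acts_nonempty[OF that] unfolding acts_against_def by simp
    show "s \<in> states2 G \<longleftrightarrow> dest G (p s) \<in> states2 G"
      if p: "\<And>t. t < n \<Longrightarrow> p t \<in> acts_against \<sigma> t" and s: "s < n"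
        and "cyclic (\<lambda>t. dest G (p t)) s" for p s
    proof -
      have p': "p t \<in> acts G t" if "t < n" for t using sub[OF that p[OF that]] .
      have "dest G (p s) < n" using dest_less acts(1) p'[OF s] by blast
      then show ?thesis using cyclic_same_player[OF p' s that(3)] states2_iff s by simp
    qed
  qed (use acts[OF sub] dest_less[OF acts(1)[OF sub]] discount in auto)
qed

section \<open>Profiles and pivots of the method\<close>

definition valid :: "profile \<Rightarrow> bool" where
  "valid \<pi> \<longleftrightarrow> fst \<pi> \<in> strategies1 G \<and> snd \<pi> \<in> strategies2 G"

abbreviation val :: "profile \<Rightarrow> nat \<Rightarrow> real" where
  "val \<equiv> value_vec G"

lemma played_policy: "valid \<pi> \<Longrightarrow> one.policy (played G \<pi>)"
  unfolding one.policy_def valid_def played_def using strategy_acts states2_iff by auto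

lemma played_acts: "valid \<pi> \<Longrightarrow> s < n \<Longrightarrow> played G \<pi> s \<in> acts G s"
  using played_policy one.policyD by blast

lemma sum_prob:
  assumes "a < m"
  shows "(\<Sum>t<n. prob G a t * v t) = v (dest G a)"
proof -
  have "(\<Sum>t<n. prob G a t * v t) = (\<Sum>t<n. if t = dest G a then v t else 0)"
    unfolding prob_def by (intro sum.cong) auto
  then show ?thesis using dest_less[OF assms] by simp
qed

lemma
  assumes "valid \<pi>"
  shows value_vec: "one.value_of (played G \<pi>) (val \<pi>)"
    and value_vec_extensional: "val \<pi> \<in> extensional {..<n}"
proof -
  note pol = played_policy[OF assms]
  have eq: "(\<forall>s<n. v s = cost G (played G \<pi> s)
      + discount G * (\<Sum>t<n. prob G (played G \<pi> s) t * v t)) \<longleftrightarrow> one.value_of (played G \<pi>) v" for v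
    unfolding one.value_of_def using sum_prob acts(1)[OF played_acts[OF assms]] by auto
  obtain v where v: "one.value_of (played G \<pi>) v" using one.value_exists[OF pol] by blast
  have "val \<pi> = (THE v. v \<in> extensional {..<n} \<and> one.value_of (played G \<pi>) v)"
    unfolding value_vec_def eq ..
  also have "\<dots> = restrict v {..<n}"
  proof (rule the_equality)
    show "restrict v {..<n} \<in> extensional {..<n} \<and> one.value_of (played G \<pi>) (restrict v {..<n})"
      using v one.nxt_less[OF pol] unfolding one.value_of_def by simp
    show "w = restrict v {..<n}"
      if "w \<in> extensional {..<n} \<and> one.value_of (played G \<pi>) w" for w
      by (rule extensionalityI) (use that one.value_unique[OF pol v, of w] in auto)
  qed
  finally have val: "val \<pi> = restrict v {..<n}" .
  show "one.value_of (played G \<pi>) (val \<pi>)"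
    using v one.nxt_less[OF pol] unfolding val one.value_of_def by simp
  show "val \<pi> \<in> extensional {..<n}" unfolding val by simp
qed

lemma reduced_cost: "a < m \<Longrightarrow> reduced_cost G \<pi> a = one.red (val \<pi>) a"
  unfolding reduced_cost_def one.red_def by (simp add: sum_prob)

lemma acts12: "a \<in> acts1 G \<longleftrightarrow> a < m \<and> loc G a \<in> states1 G"
  "a \<in> acts2 G \<longleftrightarrow> a < m \<and> loc G a \<in> states2 G"
  unfolding acts1_def acts2_def acts_def by auto

lemma entering1_empty: "entering1 G \<pi> = {} \<longleftrightarrow> (\<forall>a\<in>acts1 G. 0 \<le> reduced_cost G \<pi> a)"
proof
  assume empty: "entering1 G \<pi> = {}"
  show "\<forall>a\<in>acts1 G. 0 \<le> reduced_cost G \<pi> a"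
  proof (rule ccontr)
    assume "\<not> ?thesis"
    then obtain b where b: "b \<in> acts1 G" "reduced_cost G \<pi> b < 0" by force
    have "finite (acts1 G)" by (rule finite_subset[OF _ finite_lessThan[of m]]) (auto simp: acts12)
    then obtain a where a: "is_arg_min (reduced_cost G \<pi>) (\<lambda>a. a \<in> acts1 G) a"
      using ex_is_arg_min_if_finite b(1) by blast
    then have "\<forall>b\<in>acts1 G. reduced_cost G \<pi> a \<le> reduced_cost G \<pi> b" "a \<in> acts1 G"
      unfolding is_arg_min_linorder by auto
    then have "a \<in> entering1 G \<pi>" using b unfolding entering1_def by force
    then show False using empty by blast
  qed
qed (auto simp: entering1_def)

lemma entering2_empty: "entering2 G \<pi> = {} \<longleftrightarrow> (\<forall>a\<in>acts2 G. reduced_cost G \<pi> a \<le> 0)"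
proof
  assume empty: "entering2 G \<pi> = {}"
  show "\<forall>a\<in>acts2 G. reduced_cost G \<pi> a \<le> 0"
  proof (rule ccontr)
    assume "\<not> ?thesis"
    then obtain b where b: "b \<in> acts2 G" "0 < reduced_cost G \<pi> b" by force
    have "finite (acts2 G)" by (rule finite_subset[OF _ finite_lessThan[of m]]) (auto simp: acts12)
    then obtain a where a: "is_arg_min (\<lambda>a. - reduced_cost G \<pi> a) (\<lambda>a. a \<in> acts2 G) a"
      using ex_is_arg_min_if_finite b(1) by blast
    then have "\<forall>b\<in>acts2 G. reduced_cost G \<pi> b \<le> reduced_cost G \<pi> a" "a \<in> acts2 G"
      unfolding is_arg_min_linorder by auto
    then have "a \<in> entering2 G \<pi>" using b unfolding entering2_def by force
    then show False using empty by blast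
  qed
qed (auto simp: entering2_def)

text \<open>These are the profiles at which an iteration may start: \<open>\<tau>\<close> is a best response to \<open>\<sigma>\<close>.\<close>
definition settled :: "profile \<Rightarrow> bool" where
  "settled \<pi> \<longleftrightarrow> valid \<pi> \<and> entering2 G \<pi> = {}"

lemma settled_answered:
  assumes "settled \<pi>"
  shows "one.answered (played G \<pi>) (val \<pi>)"
proof -
  have v: "valid \<pi>" "\<forall>a\<in>acts2 G. reduced_cost G \<pi> a \<le> 0"
    using assms unfolding settled_def entering2_empty by auto
  have "one.red (val \<pi>) a \<le> 0" if "s < n" "s \<notin> states1 G" "a \<in> acts G s" for s a
  proof -
    have "a \<in> acts2 G" using that acts states2_iff by (auto simp: acts12)
    then show ?thesis using v(2) reduced_cost acts(1)[OF that(3)] by metis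
  qed
  then show ?thesis
    unfolding one.answered_def using played_policy[OF v(1)] value_vec[OF v(1)] by auto
qed

lemma switch_valid:
  "valid (\<sigma>, \<tau>) \<Longrightarrow> a \<in> acts1 G \<Longrightarrow> valid (\<sigma>(loc G a := a), \<tau>)"
  "valid (\<sigma>, \<tau>) \<Longrightarrow> a \<in> acts2 G \<Longrightarrow> valid (\<sigma>, \<tau>(loc G a := a))"
proof -
  show "valid (\<sigma>(loc G a := a), \<tau>)" if "valid (\<sigma>, \<tau>)" "a \<in> acts1 G"
    using that unfolding valid_def strategies1_def
    by (auto simp: acts12 acts_def PiE_iff extensional_def)
  show "valid (\<sigma>, \<tau>(loc G a := a))" if "valid (\<sigma>, \<tau>)" "a \<in> acts2 G"
    using that unfolding valid_def strategies2_def
    by (auto simp: acts12 acts_def PiE_iff extensional_def)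
qed

text \<open>One outer iteration, from a profile to the next, with the inner simplex method taken as a whole.\<close>
definition improve1 :: "profile \<Rightarrow> profile \<Rightarrow> bool" where
  "improve1 \<pi> \<rho> \<longleftrightarrow> settled \<pi> \<and> settled \<rho> \<and>
     (\<exists>a\<in>entering1 G \<pi>. fst \<rho> = (fst \<pi>)(loc G a := a))"

definition improve2 :: "strategy \<Rightarrow> profile \<Rightarrow> profile \<Rightarrow> bool" where
  "improve2 \<sigma> \<rho> \<rho>' \<longleftrightarrow> valid \<rho> \<and> fst \<rho> = \<sigma> \<and>
     (\<exists>a\<in>entering2 G \<rho>. \<rho>' = (\<sigma>, (snd \<rho>)(loc G a := a)))"

lemma improve1_pivot:
  assumes "improve1 \<pi> \<rho>"
  shows "one.pivot (played G \<pi>, val \<pi>) (played G \<rho>, val \<rho>)"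
proof -
  obtain a where a: "settled \<pi>" "settled \<rho>" "a \<in> entering1 G \<pi>" "fst \<rho> = (fst \<pi>)(loc G a := a)"
    using assms unfolding improve1_def by blast
  have am: "a < m" "loc G a \<in> states1 G" "a \<in> acts1 G" using a(3) unfolding entering1_def acts12 by auto
  have pa: "played G \<rho> (loc G a) = a" using a(4) am unfolding played_def by simp
  have "one.red (val \<pi>) a < 0" using a(3) reduced_cost am(1) unfolding entering1_def by auto
  moreover have "one.red (val \<pi>) a \<le> one.red (val \<pi>) b" if "t \<in> states1 G" "b \<in> acts G t" for t b
  proof -
    have b: "b < m" "b \<in> acts1 G" using that unfolding acts1_def by (auto simp: acts)
    show ?thesis using a(3) b(2) unfolding entering1_def
      by (auto simp: reduced_cost[OF am(1), symmetric] reduced_cost[OF b(1), symmetric])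
  qed
  moreover have "played G \<rho> t = played G \<pi> t" if "t \<in> states1 G" "t \<noteq> loc G a" for t
    using a(4) that unfolding played_def by simp
  ultimately show ?thesis
    using settled_answered[OF a(1)] settled_answered[OF a(2)] am(2) pa
    unfolding one.pivot.simps by (intro conjI bexI[of _ "loc G a"]) auto
qed

lemma improve2_valid: "improve2 \<sigma> \<rho> \<rho>' \<Longrightarrow> valid \<rho>'"
  unfolding improve2_def using switch_valid(2)[of \<sigma> "snd \<rho>"]
  by (cases \<rho>) (auto simp: entering2_def)

text \<open>A follower with one action per state is at a best response trivially: the reduced cost of the action
  played is zero.\<close>
lemma valid_answered2:
  assumes "valid \<rho>" "fst \<rho> = \<sigma>"
  shows "forward_game.answered n (states2 G) (acts_against \<sigma>) (loc G) (dest G)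
    (\<lambda>a. - cost G a) (discount G) (played G \<rho>) (\<lambda>s. - val \<rho> s)"
proof -
  have \<sigma>: "\<sigma> \<in> strategies1 G" using assms unfolding valid_def by auto
  interpret two: forward_game n m "states2 G" "acts_against \<sigma>" "loc G" "dest G"
    "\<lambda>a. - cost G a" "discount G"
    using two[OF \<sigma>] .
  have pol: "two.policy (played G \<rho>)"
    unfolding two.policy_def acts_against_def played_def
    using assms strategy_acts(2)[of "snd \<rho>"] states states2_iff unfolding valid_def by auto
  have value_of: "two.value_of (played G \<rho>) (\<lambda>s. - val \<rho> s)"
    using value_vec[OF assms(1)] unfolding one.value_of_def two.value_of_def by auto
  have "two.red (\<lambda>s. - val \<rho> s) a \<le> 0" if s: "s < n" "s \<notin> states2 G" "a \<in> acts_against \<sigma> s" for s a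
  proof -
    have "a = played G \<rho> s"
      using s states2_iff assms(2) unfolding acts_against_def played_def by auto
    then show ?thesis using two.red_zero[OF pol value_of s(1)] by simp
  qed
  then show ?thesis unfolding two.answered_def using pol value_of by auto
qed

lemma improve2_pivot:
  assumes "improve2 \<sigma> \<rho> \<rho>'"
  shows "forward_game.pivot n (states2 G) (acts_against \<sigma>) (loc G) (dest G)
    (\<lambda>a. - cost G a) (discount G) (played G \<rho>, \<lambda>s. - val \<rho> s) (played G \<rho>', \<lambda>s. - val \<rho>' s)"
proof -
  obtain a where a: "valid \<rho>" "fst \<rho> = \<sigma>" "a \<in> entering2 G \<rho>" "\<rho>' = (\<sigma>, (snd \<rho>)(loc G a := a))"
    using assms unfolding improve2_def by blast
  have \<sigma>: "\<sigma> \<in> strategies1 G" using a(1,2) unfolding valid_def by auto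
  interpret two: forward_game n m "states2 G" "acts_against \<sigma>" "loc G" "dest G"
    "\<lambda>a. - cost G a" "discount G"
    using two[OF \<sigma>] .
  have am: "a < m" "loc G a \<in> states2 G" "a \<in> acts2 G" using a(3) unfolding entering2_def acts12 by auto
  have red: "two.red (\<lambda>s. - val \<rho> s) b = - reduced_cost G \<rho> b" if "b < m" for b
    unfolding reduced_cost[OF that] one.red_def two.red_def by simp
  have not1: "s \<notin> states1 G" if "s \<in> states2 G" for s using that states(2) by auto
  have pa: "played G \<rho>' (loc G a) = a" using a(4) not1[OF am(2)] unfolding played_def by simp
  have "two.red (\<lambda>s. - val \<rho> s) a < 0" using a(3) red am(1) unfolding entering2_def by auto
  moreover have "two.red (\<lambda>s. - val \<rho> s) a \<le> two.red (\<lambda>s. - val \<rho> s) b"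
    if "t \<in> states2 G" "b \<in> acts_against \<sigma> t" for t b
  proof -
    have b: "b \<in> acts G t" using that unfolding acts_against_def by auto
    then have b: "b < m" "b \<in> acts2 G" using that(1) unfolding acts2_def by (auto simp: acts)
    show ?thesis using a(3) b(2) unfolding entering2_def red[OF am(1)] red[OF b(1)] by auto
  qed
  moreover have "played G \<rho>' t = played G \<rho> t" if "t \<in> states2 G" "t \<noteq> loc G a" for t
    using a(4) that not1 unfolding played_def by simp
  moreover have "valid \<rho>'" "fst \<rho>' = \<sigma>" using improve2_valid[OF assms] a(4) by auto
  ultimately show ?thesis
    using valid_answered2[OF a(1,2)] valid_answered2[of \<rho>' \<sigma>] am(2) pa
    unfolding two.pivot.simps by (intro conjI bexI[of _ "loc G a"]) auto
qed

lemma relpowp_map: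
  "(R ^^ k) x y \<Longrightarrow> (\<And>x y. R x y \<Longrightarrow> S (f x) (f y)) \<Longrightarrow> (S ^^ k) (f x) (f y)"
  by (induction k arbitrary: y) (auto simp: relcompp_apply)

abbreviation N :: nat where "N \<equiv> one.max_run"

lemma improve1_length: "(improve1 ^^ k) \<pi> \<rho> \<Longrightarrow> k < N"
  by (rule one.run_length[of _ "(played G \<pi>, val \<pi>)" "(played G \<rho>, val \<rho>)"],
      rule relpowp_map[where f = "\<lambda>\<pi>. (played G \<pi>, val \<pi>)"])
    (assumption | rule improve1_pivot)+

lemma improve2_length:
  assumes "(improve2 \<sigma> ^^ k) \<rho> \<rho>'"
  shows "k < N"
proof (cases "k = 0")
  case True
  then show ?thesis
    unfolding one.max_run_def one.cycle_block_def one.path_block_def by simp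
next
  case False
  then have "\<exists>\<rho>1. improve2 \<sigma> \<rho> \<rho>1" using assms by (metis not0_implies_Suc relpowp_Suc_D2)
  then have "\<sigma> \<in> strategies1 G" unfolding improve2_def valid_def by auto
  then interpret two: forward_game n m "states2 G" "acts_against \<sigma>" "loc G" "dest G"
    "\<lambda>a. - cost G a" "discount G"
    by (rule two)
  have "(two.pivot ^^ k) (played G \<rho>, \<lambda>s. - val \<rho> s) (played G \<rho>', \<lambda>s. - val \<rho>' s)"
    using assms by (rule relpowp_map[where f = "\<lambda>\<rho>. (played G \<rho>, \<lambda>s. - val \<rho> s)"])
      (rule improve2_pivot)
  then show ?thesis by (rule two.run_length)
qed

section \<open>Optimality\<close>

lemma red_played: "valid \<pi> \<Longrightarrow> s < n \<Longrightarrow> one.red (val \<pi>) (played G \<pi> s) = 0"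
  using one.red_zero[OF played_policy value_vec] by blast

lemma optimal_if_no_entering:
  assumes set: "settled \<pi>" and e1: "entering1 G \<pi> = {}"
  shows "optimal_profile G \<pi>"
proof -
  obtain \<sigma> \<tau> where \<pi>: "\<pi> = (\<sigma>, \<tau>)" by (cases \<pi>)
  have v: "valid \<pi>" "\<sigma> \<in> strategies1 G" "\<tau> \<in> strategies2 G"
    using set unfolding settled_def valid_def \<pi> by auto
  have r1: "0 \<le> one.red (val \<pi>) a" if "s \<in> states1 G" "a \<in> acts G s" for a s
    using e1 that acts reduced_cost unfolding entering1_empty by (metis acts12(1))
  have r2: "one.red (val \<pi>) a \<le> 0" if "s \<in> states2 G" "a \<in> acts G s" for a s
    using set that acts reduced_cost unfolding settled_def entering2_empty by (metis acts12(2))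
  have "val \<pi> s \<le> val (\<sigma>', \<tau>) s" if s: "\<sigma>' \<in> strategies1 G" "s < n" for \<sigma>' s
  proof -
    have v': "valid (\<sigma>', \<tau>)" using that v unfolding valid_def by simp
    have red: "0 \<le> one.red (val \<pi>) (played G (\<sigma>', \<tau>) t)" if "t < n" for t
    proof (cases "t \<in> states1 G")
      case True
      then show ?thesis using r1[OF True] strategy_acts(1)[OF s(1)] unfolding played_def by simp
    next
      case False
      then have "played G (\<sigma>', \<tau>) t = played G \<pi> t" unfolding played_def \<pi> by simp
      then show ?thesis using red_played[OF v(1) that] by simp
    qed
    show ?thesis
      using one.value_loss_of_red[OF played_policy[OF v'] value_vec[OF v'] red s(2)] red[OF s(2)] by simp
  qed
  moreover have "val (\<sigma>, \<tau>') s \<le> val \<pi> s" if s: "\<tau>' \<in> strategies2 G" "s < n" for \<tau>' s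
  proof -
    have v': "valid (\<sigma>, \<tau>')" using that v unfolding valid_def by simp
    have red: "one.red (val \<pi>) (played G (\<sigma>, \<tau>') t) \<le> 0" if "t < n" for t
    proof (cases "t \<in> states1 G")
      case False
      then have "t \<in> states2 G" using states2_iff[OF that] by simp
      then show ?thesis
        using r2[OF \<open>t \<in> states2 G\<close>] strategy_acts(2)[OF s(1)] False unfolding played_def by simp
    next
      case True
      then have "played G (\<sigma>, \<tau>') t = played G \<pi> t" unfolding played_def \<pi> by simp
      then show ?thesis using red_played[OF v(1) that] by simp
    qed
    show ?thesis
      using one.value_gain_of_red[OF played_policy[OF v'] value_vec[OF v'] red s(2)] red[OF s(2)] by simp
  qed
  ultimately show ?thesis
    using v unfolding optimal_profile_def best_response1_def best_response2_def \<pi> by simp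
qed

text \<open>An entering action would be a deviation that strictly improves the value of its own state.\<close>
lemma best_response_settled:
  assumes "\<sigma> \<in> strategies1 G" "best_response2 G \<sigma> \<tau>"
  shows "settled (\<sigma>, \<tau>)"
proof -
  have v: "valid (\<sigma>, \<tau>)" using assms unfolding valid_def best_response2_def by simp
  have False if a: "a \<in> entering2 G (\<sigma>, \<tau>)" for a
  proof -
    let ?\<rho> = "(\<sigma>, \<tau>(loc G a := a))" and ?v = "val (\<sigma>, \<tau>)"
    have am: "a < m" "a \<in> acts2 G" "loc G a \<in> states2 G"
      using a unfolding entering2_def by (auto simp: acts12)
    have pos: "0 < one.red ?v a" using a reduced_cost[OF am(1)] unfolding entering2_def by simp
    have v': "valid ?\<rho>" using switch_valid(2)[OF v am(2)] .
    have pa: "played G ?\<rho> t = (if t = loc G a then a else played G (\<sigma>, \<tau>) t)" for t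
      using am(3) states(2) unfolding played_def by auto
    have red: "0 \<le> one.red ?v (played G ?\<rho> t)" if "t < n" for t
      using pos red_played[OF v that] unfolding pa by simp
    have "?v (loc G a) + one.red ?v a \<le> val ?\<rho> (loc G a)"
      using one.value_loss_of_red[OF played_policy[OF v'] value_vec[OF v'] red loc_less[OF am(1)]]
      unfolding pa by simp
    moreover have "val ?\<rho> (loc G a) \<le> ?v (loc G a)"
      using assms(2) v' loc_less[OF am(1)] unfolding best_response2_def valid_def by simp
    ultimately show False using pos by simp
  qed
  then show ?thesis using v unfolding settled_def by blast
qed

text \<open>So the method cannot stop in an iteration in which Player 1 has switched.\<close>
lemma improve1_changes_value:
  assumes "improve1 \<pi> \<rho>"
  shows "val \<rho> \<noteq> val \<pi>"
proof -
  note piv = improve1_pivot[OF assms]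
  obtain s where s: "s \<in> states1 G" "one.red (val \<pi>) (played G \<rho> s) < 0"
    using piv by (elim one.pivotE) blast
  have "val \<rho> s < val \<pi> s" using one.pivot_gain[OF piv state_less(1)[OF s(1)]] s(2) by simp
  then show ?thesis by auto
qed

section \<open>Executions\<close>

text \<open>The invariant of a configuration reached from \<open>Iterate \<pi>0\<close> by \<open>t\<close> transitions with \<open>p\<close> pivot steps;
  \<open>k\<close> is the number of complete iterations in which Player 1 has switched. Each of them takes one switch of
  Player 1, fewer than \<open>N\<close> switches of Player 2, and one transition to the next iteration. While Player 2
  responds, either Player 1 had nothing to switch, and then the profile is unchanged, or \<open>j\<close> inner
  pivots have been made.\<close>
fun reached :: "profile \<Rightarrow> config \<Rightarrow> nat \<Rightarrow> nat \<Rightarrow> bool" where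
  "reached \<pi>0 (Iterate \<pi>) t p \<longleftrightarrow> settled \<pi> \<and>
     (\<exists>k. (improve1 ^^ k) \<pi>0 \<pi> \<and> p \<le> k * (N + 1) \<and> t \<le> k * (N + 2))"
| "reached \<pi>0 (Respond \<pi> \<rho>) t p \<longleftrightarrow> settled \<pi> \<and> valid \<rho> \<and>
     (\<exists>k. (improve1 ^^ k) \<pi>0 \<pi> \<and>
       (\<rho> = \<pi> \<and> entering1 G \<pi> = {} \<and> p \<le> k * (N + 1) \<and> t \<le> k * (N + 2) + 1 \<or>
        (\<exists>a\<in>entering1 G \<pi>. \<exists>j. fst \<rho> = (fst \<pi>)(loc G a := a) \<and>
          (improve2 (fst \<rho>) ^^ j) ((fst \<pi>)(loc G a := a), snd \<pi>) \<rho> \<and>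
          p \<le> k * (N + 1) + 1 + j \<and> t \<le> k * (N + 2) + 1 + j)))"
| "reached \<pi>0 (Finished \<pi>) t p \<longleftrightarrow> optimal_profile G \<pi> \<and>
     (\<exists>k<N. p \<le> k * (N + 1) \<and> t \<le> k * (N + 2) + 2)"

lemma reached_step:
  assumes "reached \<pi>0 c t p" "ssi_step G c k c'"
  shows "reached \<pi>0 c' (Suc t) (p + k)"
  using assms(2,1)
proof (cases rule: ssi_step.cases)
  case (switch1 a \<sigma> \<tau>)
  have "a \<in> acts1 G" using switch1 unfolding entering1_def by simp
  moreover have "valid (\<sigma>, \<tau>)" using assms(1) switch1 by (simp add: settled_def)
  ultimately have "valid (\<sigma>(loc G a := a), \<tau>)" using switch_valid(1) by blast
  moreover obtain l where l: "settled (\<sigma>, \<tau>)" "(improve1 ^^ l) \<pi>0 (\<sigma>, \<tau>)"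
    "p \<le> l * (N + 1)" "t \<le> l * (N + 2)"
    using assms(1) unfolding switch1(1) reached.simps by blast
  have "\<exists>a'\<in>entering1 G (\<sigma>, \<tau>). \<exists>j. fst (\<sigma>(loc G a := a), \<tau>) = (fst (\<sigma>, \<tau>))(loc G a' := a') \<and>
      (improve2 (fst (\<sigma>(loc G a := a), \<tau>)) ^^ j)
        ((fst (\<sigma>, \<tau>))(loc G a' := a'), snd (\<sigma>, \<tau>)) (\<sigma>(loc G a := a), \<tau>) \<and>
      p + k \<le> l * (N + 1) + 1 + j \<and> Suc t \<le> l * (N + 2) + 1 + j"
    using l(3,4) switch1(2,4) by (intro bexI[of _ a] exI[of _ 0]) auto
  ultimately show ?thesis unfolding switch1(3) reached.simps using l(1,2) by blast
next
  case (stay1 \<pi>)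
  then show ?thesis using assms(1) by (auto simp: settled_def)
next
  case (switch2 a \<sigma> \<tau> \<pi>)
  note r = assms(1)[unfolded switch2(1), simplified]
  have "entering2 G \<pi> = {}" using r unfolding settled_def by simp
  then have ne: "(\<sigma>, \<tau>) \<noteq> \<pi>" using switch2 by auto
  have imp: "improve2 \<sigma> (\<sigma>, \<tau>) (\<sigma>, \<tau>(loc G a := a))"
    unfolding improve2_def using switch2 r by auto
  obtain l b j where *: "(improve1 ^^ l) \<pi>0 \<pi>" "b \<in> entering1 G \<pi>"
    "\<sigma> = (fst \<pi>)(loc G b := b)"
    "(improve2 \<sigma> ^^ j) ((fst \<pi>)(loc G b := b), snd \<pi>) (\<sigma>, \<tau>)"
    "p \<le> l * (N + 1) + 1 + j" "t \<le> l * (N + 2) + 1 + j"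
    using r ne by auto
  have "(improve2 \<sigma> ^^ Suc j) ((fst \<pi>)(loc G b := b), snd \<pi>) (\<sigma>, \<tau>(loc G a := a))"
    using *(4) imp by auto
  then have "\<exists>b\<in>entering1 G \<pi>. \<exists>j. \<sigma> = (fst \<pi>)(loc G b := b) \<and>
      (improve2 \<sigma> ^^ j) ((fst \<pi>)(loc G b := b), snd \<pi>) (\<sigma>, \<tau>(loc G a := a)) \<and>
      p + k \<le> l * (N + 1) + 1 + j \<and> Suc t \<le> l * (N + 2) + 1 + j"
    using *(2,3,5,6) switch2 by (intro bexI[of _ b] exI[of _ "Suc j"]) auto
  then show ?thesis
    unfolding switch2(3) reached.simps fst_conv using r *(1) improve2_valid[OF imp] by blast
next
  case (continue \<rho> \<pi>)
  note r = assms(1)[unfolded continue(1), simplified]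
  obtain l b j where *: "(improve1 ^^ l) \<pi>0 \<pi>" "b \<in> entering1 G \<pi>"
    "fst \<rho> = (fst \<pi>)(loc G b := b)"
    "(improve2 (fst \<rho>) ^^ j) ((fst \<pi>)(loc G b := b), snd \<pi>) \<rho>"
    "p \<le> l * (N + 1) + 1 + j" "t \<le> l * (N + 2) + 1 + j"
    using r continue by auto
  have set: "settled \<rho>" using r continue unfolding settled_def by simp
  have "improve1 \<pi> \<rho>" unfolding improve1_def using r set *(2,3) by auto
  then have "(improve1 ^^ Suc l) \<pi>0 \<rho>" using *(1) by auto
  moreover have "j < N" using improve2_length[OF *(4)] .
  ultimately show ?thesis
    unfolding continue(3) reached.simps using set *(5,6) continue(2)
    by (intro conjI exI[of _ "Suc l"]) auto
next
  case (finish \<rho> \<pi>)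
  note r = assms(1)[unfolded finish(1), simplified]
  obtain l where l: "(improve1 ^^ l) \<pi>0 \<pi>"
    "\<rho> = \<pi> \<and> entering1 G \<pi> = {} \<and> p \<le> l * (N + 1) \<and> t \<le> l * (N + 2) + 1 \<or>
      (\<exists>a\<in>entering1 G \<pi>. fst \<rho> = (fst \<pi>)(loc G a := a))"
    using r by fastforce
  have "settled \<rho>" using r finish unfolding settled_def by simp
  then have "\<not> (\<exists>a\<in>entering1 G \<pi>. fst \<rho> = (fst \<pi>)(loc G a := a))"
    using improve1_changes_value[of \<pi> \<rho>] r finish unfolding improve1_def by auto
  then show ?thesis
    unfolding finish(3) reached.simps
    using l finish(2) improve1_length[OF l(1)] optimal_if_no_entering[of \<pi>] r by auto
qed

lemma reached_bounds:
  assumes "reached \<pi>0 c t p"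
  shows "p \<le> N * (N + 1)" "t \<le> N * (N + 2) + 1"
proof -
  have "\<exists>k<N. p \<le> k * (N + 1) + N \<and> t \<le> k * (N + 2) + N + 1"
  proof (cases c)
    case (Iterate \<pi>)
    then obtain k where k: "(improve1 ^^ k) \<pi>0 \<pi>" "p \<le> k * (N + 1)" "t \<le> k * (N + 2)"
      using assms by auto
    then show ?thesis using improve1_length[OF k(1)] by (intro exI[of _ k] conjI) linarith+
  next
    case (Respond \<pi> \<rho>)
    then obtain k where k: "(improve1 ^^ k) \<pi>0 \<pi>"
      "p \<le> k * (N + 1) \<and> t \<le> k * (N + 2) + 1 \<or>
        (\<exists>\<sigma> \<rho>' j. (improve2 \<sigma> ^^ j) \<rho>' \<rho> \<and> p \<le> k * (N + 1) + 1 + j \<and> t \<le> k * (N + 2) + 1 + j)"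
      using assms unfolding Respond reached.simps by blast
    have "p \<le> k * (N + 1) + N \<and> t \<le> k * (N + 2) + N + 1"
      using k(2)
    proof
      assume "\<exists>\<sigma> \<rho>' j. (improve2 \<sigma> ^^ j) \<rho>' \<rho> \<and> p \<le> k * (N + 1) + 1 + j \<and> t \<le> k * (N + 2) + 1 + j"
      then obtain \<sigma> \<rho>' j where "(improve2 \<sigma> ^^ j) \<rho>' \<rho>"
        "p \<le> k * (N + 1) + 1 + j" "t \<le> k * (N + 2) + 1 + j" by blast
      then show ?thesis using improve2_length[of j \<sigma> \<rho>' \<rho>] by linarith
    qed linarith
    then show ?thesis using improve1_length[OF k(1)] by blast
  next
    case (Finished \<pi>)
    then obtain k where "k < N" "p \<le> k * (N + 1)" "t \<le> k * (N + 2) + 2" using assms by auto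
    then show ?thesis by (intro exI[of _ k] conjI) linarith+
  qed
  then obtain k where k: "k < N" "p \<le> k * (N + 1) + N" "t \<le> k * (N + 2) + N + 1" by blast
  have "(k + 1) * (N + 1) \<le> N * (N + 1)" "(k + 1) * (N + 2) \<le> N * (N + 2)"
    using k(1) by (intro mult_right_mono; simp)+
  then show "p \<le> N * (N + 1)" "t \<le> N * (N + 2) + 1" using k(2,3) by (simp_all add: algebra_simps)
qed

lemma converges:
  assumes "settled \<pi>0"
  shows "ssi_converges G (Iterate \<pi>0)"
proof -
  have start: "reached \<pi>0 (Iterate \<pi>0) 0 0" using assms by (auto intro: exI[of _ 0])
  have exec: "\<exists>t. reached \<pi>0 c' t p" if "ssi_exec G (Iterate \<pi>0) p q c'" for p q c'
    using that
  proof induction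
    case (extend p q c' k c'')
    then obtain t where "reached \<pi>0 c' t p" by blast
    then show ?case using reached_step[OF _ extend(2)] by blast
  qed (use start in blast)
  have "\<exists>p. reached \<pi>0 (f i) i p"
    if f: "f 0 = Iterate \<pi>0" "\<And>i. \<exists>k. ssi_step G (f i) k (f (Suc i))" for f i
  proof (induction i)
    case 0 then show ?case using start f by auto
  next
    case (Suc i)
    then obtain p where p: "reached \<pi>0 (f i) i p" by blast
    obtain k where "ssi_step G (f i) k (f (Suc i))" using f(2) by blast
    then show ?case using reached_step[OF p] by blast
  qed
  then have False if "f 0 = Iterate \<pi>0" "\<And>i. \<exists>k. ssi_step G (f i) k (f (Suc i))" for f
    using reached_bounds(2)[of \<pi>0 "f (N * (N + 2) + 2)" "N * (N + 2) + 2"] that by fastforce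
  then have "\<not> (\<exists>f. f 0 = Iterate \<pi>0 \<and> (\<forall>i. \<exists>k. ssi_step G (f i) k (f (Suc i))))"
    by blast
  moreover have "\<exists>\<pi>. c' = Finished \<pi> \<and> optimal_profile G \<pi>"
    if "ssi_exec G (Iterate \<pi>0) p q c'" "\<not> (\<exists>k c''. ssi_step G c' k c'')" for p q c'
  proof (cases c')
    case (Iterate \<pi>)
    obtain \<sigma> \<tau> where "\<pi> = (\<sigma>, \<tau>)" by (cases \<pi>)
    then show ?thesis using that(2) Iterate ssi_step.switch1 ssi_step.stay1 by (metis ex_in_conv)
  next
    case (Respond \<pi> \<rho>)
    obtain \<sigma> \<tau> where "\<rho> = (\<sigma>, \<tau>)" by (cases \<rho>)
    then show ?thesis
      using that(2) Respond ssi_step.switch2 ssi_step.continue ssi_step.finish by (metis ex_in_conv)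
  next
    case (Finished \<pi>)
    then show ?thesis using exec[OF that(1)] by auto
  qed
  ultimately show ?thesis unfolding ssi_converges_def by blast
qed

end

section \<open>Correctness and cost of the programs\<close>

text \<open>The number of operations is only bounded, since the loop around a cycle stops early. Quantifying over
  the initial counter \<open>k\<close> makes the notion compositional.\<close>
definition computes :: "'a counted \<Rightarrow> 'a \<Rightarrow> nat \<Rightarrow> bool" where
  "computes p x W \<longleftrightarrow> (\<forall>k. \<exists>c\<le>W. run_state p k = (x, k + c))"

lemma computes_result: "computes p x W \<Longrightarrow> result p = x"
  unfolding computes_def result_def by (metis fst_conv)

lemma computes_ops: "computes p x W \<Longrightarrow> ops p \<le> W"
  unfolding computes_def ops_def by (metis add_0 snd_conv)

lemma computes_mono: "computes p x W \<Longrightarrow> W \<le> W' \<Longrightarrow> computes p x W'"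
  unfolding computes_def by (meson order_trans)

lemma computes_return: "computes (State_Monad.return x) x W"
  unfolding computes_def by (auto intro: exI[of _ 0])

lemma computes_tick: "computes (tick x) x 1"
  unfolding computes_def tick_def by (auto intro: exI[of _ 1])

lemma computes_bind:
  assumes "computes p x V" "computes (f x) y W"
  shows "computes (State_Monad.bind p f) y (V + W)"
  unfolding computes_def
proof
  fix k
  obtain c where c: "c \<le> V" "run_state p k = (x, k + c)"
    using assms(1) unfolding computes_def by blast
  obtain d where d: "d \<le> W" "run_state (f x) (k + c) = (y, k + c + d)"
    using assms(2) unfolding computes_def by blast
  show "\<exists>c\<le>V + W. run_state (State_Monad.bind p f) k = (y, k + c)"
    using c d by (intro exI[of _ "c + d"]) simp
qed

lemma computes_tick_bind:
  assumes "computes (f x) y W"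
  shows "computes (State_Monad.bind (tick x) f) y (Suc W)"
  using computes_bind[where f = f, OF computes_tick assms] by simp

lemma computes_traverse:
  assumes "\<And>a. a \<in> set xs \<Longrightarrow> computes (f a) (h a) W"
  shows "computes (State_Monad.traverse_list f xs) (map h xs) (length xs * W)"
  using assms
proof (induction xs)
  case Nil
  then show ?case by (simp add: computes_return)
next
  case (Cons a xs)
  have "computes (State_Monad.traverse_list f (a # xs)) (h a # map h xs) (W + (length xs * W + 0))"
    unfolding State_Monad.traverse_list.simps
    by (intro computes_bind[where x = "h a"] computes_bind[where x = "map h xs"] computes_return)
      (use Cons in auto)
  then show ?case by simp
qed

text \<open>The assumptions describe a strict weak order, which covers both \<open><\<close> and \<open>>\<close>.\<close>
lemma best_prog:
  fixes better :: "real \<Rightarrow> real \<Rightarrow> bool"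
  assumes asym: "\<And>a b. better a b \<Longrightarrow> \<not> better b a"
    and trans: "\<And>a b c. \<not> better a b \<Longrightarrow> \<not> better b c \<Longrightarrow> \<not> better a c"
  shows "\<exists>r\<in>insert x (set ys). (\<forall>y\<in>insert x (set ys). \<not> better y r) \<and>
    computes (best_prog better x ys) r (length ys)"
proof (induction ys arbitrary: x)
  case Nil
  then show ?case using asym by (auto intro: computes_return)
next
  case (Cons y ys)
  let ?x = "if better y x then y else x"
  obtain r where r: "r \<in> insert ?x (set ys)" "\<forall>y\<in>insert ?x (set ys). \<not> better y r"
    "computes (best_prog better ?x ys) r (length ys)"
    using Cons.IH by blast
  have "\<not> better x ?x" "\<not> better y ?x" using asym by auto
  then have "\<not> better x r" "\<not> better y r" using r(2) trans by blast+
  moreover have "r \<in> insert x (set (y # ys))" using r(1) by (auto split: if_splits)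
  moreover have "computes (best_prog better x (y # ys)) r (Suc (length ys))"
    unfolding best_prog.simps by (rule computes_tick_bind) (rule r(3))
  ultimately show ?case using r(2) by auto
qed

context tbdfg
begin

abbreviation moves :: "profile \<Rightarrow> nat \<Rightarrow> nat" where
  "moves \<pi> \<equiv> \<lambda>s. dest G (played G \<pi> s)"

lemma val_move:
  "valid \<pi> \<Longrightarrow> s < n \<Longrightarrow> val \<pi> s = cost G (played G \<pi> s) + discount G * val \<pi> (moves \<pi> s)"
  using one.value_ofD[OF value_vec] .

lemma moves_closed: "valid \<pi> \<Longrightarrow> moves \<pi> ` {..<n} \<subseteq> {..<n}"
  using one.nxt_closed[OF played_policy] .

lemma walk_prog:
  assumes "valid \<pi>" "s < n"
  shows "computes (walk_prog G \<pi> k s (val \<pi> ((moves \<pi> ^^ k) s))) (val \<pi> s) (2 * k)"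
  using assms(2)
proof (induction k arbitrary: s)
  case 0
  then show ?case by (simp add: computes_return)
next
  case (Suc k)
  have "moves \<pi> s < n" using moves_closed[OF assms(1)] Suc.prems by auto
  then have "computes (walk_prog G \<pi> k (moves \<pi> s) (val \<pi> ((moves \<pi> ^^ Suc k) s)))
      (val \<pi> (moves \<pi> s)) (2 * k)"
    using Suc.IH[of "moves \<pi> s"] by (simp add: funpow_Suc_right del: funpow.simps(2))
  then have "computes (walk_prog G \<pi> (Suc k) s (val \<pi> ((moves \<pi> ^^ Suc k) s)))
      (cost G (played G \<pi> s) + discount G * val \<pi> (moves \<pi> s)) (2 * k + Suc 1)"
    unfolding walk_prog.simps by (rule computes_bind) (intro computes_tick_bind computes_tick)
  then show ?case using val_move[OF assms(1) Suc.prems] by simp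
qed

text \<open>The loop invariant is \<open>val \<pi> u = x + g * val \<pi> s\<close>: the cost \<open>x\<close> collected since \<open>u\<close>, plus the discounted
  value of the present state. Back at \<open>u\<close> it becomes a linear equation for \<open>val \<pi> u\<close>, and \<open>g < 1\<close> makes it
  uniquely solvable.\<close>
lemma cycle_prog:
  assumes v: "valid \<pi>" and s: "s < n" and j: "0 < j" "j \<le> k" "(moves \<pi> ^^ j) s = u"
    and x: "val \<pi> u = x + g * val \<pi> s" and g: "0 \<le> g" "g \<le> 1"
  shows "\<exists>x' g'. computes (cycle_prog G \<pi> u k s x g) (x', g') (3 * k) \<and>
    val \<pi> u = x' + g' * val \<pi> u \<and> g' < 1"
  using s j x g
proof (induction k arbitrary: s j x g)
  case 0
  then show ?case by simp
next
  case (Suc k)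
  let ?t = "moves \<pi> s" and ?x = "x + g * cost G (played G \<pi> s)" and ?g = "g * discount G"
  let ?q = "if ?t = u then State_Monad.return (?x, ?g) else cycle_prog G \<pi> u k ?t ?x ?g"
  have t: "?t < n" using moves_closed[OF v] Suc.prems(1) by auto
  have val: "val \<pi> u = ?x + ?g * val \<pi> ?t"
    using Suc.prems(5) val_move[OF v Suc.prems(1)] by (simp add: algebra_simps)
  have g': "0 \<le> ?g" "?g < 1"
    using Suc.prems(6,7) discount mult_right_mono[of g 1 "discount G"] by (simp, linarith)
  have step: "computes (cycle_prog G \<pi> u (Suc k) s x g) r (3 * Suc k)"
    if "computes ?q r (3 * k)" for r
  proof -
    have "computes (cycle_prog G \<pi> u (Suc k) s x g) r (Suc (Suc (Suc (3 * k))))"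
      unfolding cycle_prog.simps Let_def
      by (intro computes_tick_bind) (use that in simp)
    moreover have "3 * Suc k = Suc (Suc (Suc (3 * k)))" by simp
    ultimately show ?thesis by metis
  qed
  show ?case
  proof (cases "?t = u")
    case True
    then have "computes ?q (?x, ?g) (3 * k)" by (simp add: computes_return)
    then show ?thesis using step val g' True by metis
  next
    case False
    then have "j \<noteq> 1" using Suc.prems(4) by auto
    then have j: "0 < j - 1" "j - 1 \<le> k" using Suc.prems(2,3) by auto
    have "(moves \<pi> ^^ (j - 1)) ?t = (moves \<pi> ^^ Suc (j - 1)) s"
      by (simp only: funpow_Suc_right o_apply)
    then have "(moves \<pi> ^^ (j - 1)) ?t = u" using Suc.prems(2,4) by simp
    from Suc.IH[OF t j this val] g' obtain x' g'
      where "computes (cycle_prog G \<pi> u k ?t ?x ?g) (x', g') (3 * k)"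
        "val \<pi> u = x' + g' * val \<pi> u" "g' < 1"
      by auto
    then show ?thesis using step[of "(x', g')"] False by auto
  qed
qed

text \<open>The state \<open>u\<close> lies on a cycle of length at most \<open>n\<close>, so the bound \<open>n\<close> on the iterations of the
  loop is never what ends it.\<close>
lemma value_at_prog:
  assumes v: "valid \<pi>" and s: "s < n"
  shows "computes (value_at_prog G \<pi> s) (val \<pi> s) (5 * n + 2)"
proof -
  let ?u = "(moves \<pi> ^^ n) s"
  have closed: "moves \<pi> ` {..<n} \<subseteq> {..<n}" using moves_closed[OF v] .
  have in_n: "(moves \<pi> ^^ i) t < n" if "t < n" for i t
    using funpow_closed[OF closed, of t i] that by simp
  have "cyclic (moves \<pi>) ((moves \<pi> ^^ 1) ((moves \<pi> ^^ (n - 1)) s))"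
    using cyclic_after[OF closed s] by (rule cyclic_funpow)
  also have "(moves \<pi> ^^ 1) ((moves \<pi> ^^ (n - 1)) s) = (moves \<pi> ^^ Suc (n - 1)) s" by simp
  also have "\<dots> = ?u" using s by (cases n) auto
  finally obtain k where k: "0 < k" "(moves \<pi> ^^ k) ?u = ?u"
    "inj_on (\<lambda>i. (moves \<pi> ^^ Suc i) ?u) {0..<k}"
    by (rule cyclic_period)
  have "card {0..<k} \<le> card {..<n}"
    by (rule card_inj_on_le[OF k(3)]) (use in_n[OF in_n[OF s]] in blast)+
  then have "k \<le> n" by simp
  from cycle_prog[OF v in_n[OF s] k(1) this k(2), of 0 1]
  obtain x g where xg: "computes (cycle_prog G \<pi> ?u n ?u 0 1) (x, g) (3 * n)"
    "val \<pi> ?u = x + g * val \<pi> ?u" "g < 1"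
    by auto
  have "x = (1 - g) * val \<pi> ?u" using xg(2) by (simp add: algebra_simps)
  then have "x / (1 - g) = val \<pi> ?u" using xg(3) by simp
  then have "computes (walk_prog G \<pi> n s (x / (1 - g))) (val \<pi> s) (2 * n)"
    using walk_prog[OF v s, of n] by simp
  then have "computes (State_Monad.bind (tick (1 - g)) (\<lambda>d. State_Monad.bind (tick (x / d))
      (\<lambda>y. walk_prog G \<pi> n s y))) (val \<pi> s) (Suc (Suc (2 * n)))"
    by (intro computes_tick_bind)
  then have "computes (value_at_prog G \<pi> s) (val \<pi> s) (3 * n + Suc (Suc (2 * n)))"
    unfolding value_at_prog_def Let_def by (intro computes_bind[OF xg(1)]) simp
  then show ?thesis by simp
qed

lemma value_prog:
  assumes "valid \<pi>"
  shows "computes (value_prog G \<pi>) (map (val \<pi>) [0..<n]) (n * (5 * n + 2))"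
proof -
  have "computes (value_prog G \<pi>) (map (val \<pi>) [0..<n]) (length [0..<n] * (5 * n + 2))"
    unfolding value_prog_def by (rule computes_traverse) (use value_at_prog[OF assms] in simp)
  then show ?thesis by (simp only: length_upt diff_zero)
qed

lemma reduced_cost_prog:
  assumes "a < m"
  shows "computes (reduced_cost_prog G (map (val \<pi>) [0..<n]) a) (reduced_cost G \<pi> a) 3"
proof -
  have "computes (reduced_cost_prog G (map (val \<pi>) [0..<n]) a)
      (cost G a + discount G * map (val \<pi>) [0..<n] ! dest G a - map (val \<pi>) [0..<n] ! loc G a)
      (Suc (Suc 1))"
    unfolding reduced_cost_prog_def by (intro computes_tick_bind computes_tick)
  then show ?thesis
    using dest_less[OF assms] loc_less[OF assms]
    unfolding reduced_cost[OF assms] one.red_def by (simp add: eval_nat_numeral)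
qed

text \<open>The search starts from 0, so its result \<open>r\<close> is 0 if no action improves. Otherwise \<open>r\<close> is the
  extremal reduced cost, and the entering actions are those that attain it.\<close>
lemma entering_prog:
  assumes v: "valid \<pi>" and as: "\<And>a. a \<in> set as \<Longrightarrow> a < m" "length as \<le> m"
    and asym: "\<And>a b. better a b \<Longrightarrow> \<not> better b a"
    and trans: "\<And>a b c. \<not> better a b \<Longrightarrow> \<not> better b c \<Longrightarrow> \<not> better a c"
    and total: "\<And>a b. \<not> better a b \<Longrightarrow> \<not> better b a \<Longrightarrow> a = b"
  shows "computes (entering_prog G better as \<pi>)
    {a \<in> set as. better (reduced_cost G \<pi> a) 0 \<and>
      (\<forall>b\<in>set as. \<not> better (reduced_cost G \<pi> b) (reduced_cost G \<pi> a))}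
    (n * (5 * n + 2) + 5 * m + 1)"
proof -
  let ?rc = "reduced_cost G \<pi>"
  have "\<exists>r\<in>insert 0 (set (map ?rc as)). (\<forall>y\<in>insert 0 (set (map ?rc as)). \<not> better y r) \<and>
      computes (best_prog better 0 (map ?rc as)) r (length (map ?rc as))"
    using asym trans by (rule best_prog)
  then obtain r where r: "r \<in> insert 0 (?rc ` set as)" "\<forall>y\<in>insert 0 (?rc ` set as). \<not> better y r"
    "computes (best_prog better 0 (map ?rc as)) r (length as)"
    unfolding set_map length_map by blast
  let ?E = "if better r 0 then set (map fst (filter snd (zip as (map (\<lambda>q. q = r) (map ?rc as))))) else {}"
  have zip: "set (map fst (filter snd (zip as (map h as)))) = {a \<in> set as. h a}" for h :: "nat \<Rightarrow> bool"
    by (induction as) auto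
  have E: "?E = {a \<in> set as. better (?rc a) 0 \<and> (\<forall>b\<in>set as. \<not> better (?rc b) (?rc a))}"
  proof (cases "better r 0")
    case True
    then have "r \<noteq> 0" using asym by blast
    then have r_in: "r \<in> ?rc ` set as" using r(1) by simp
    have iff: "?rc a = r \<longleftrightarrow> better (?rc a) 0 \<and> (\<forall>b\<in>set as. \<not> better (?rc b) (?rc a))"
      if a: "a \<in> set as" for a
    proof
      assume "?rc a = r"
      then show "better (?rc a) 0 \<and> (\<forall>b\<in>set as. \<not> better (?rc b) (?rc a))" using True r(2) by blast
    next
      assume best: "better (?rc a) 0 \<and> (\<forall>b\<in>set as. \<not> better (?rc b) (?rc a))"
      obtain b where "b \<in> set as" "r = ?rc b" using r_in by blast
      then show "?rc a = r" using best a r(2) by (intro total) auto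
    qed
    have "?E = {a \<in> set as. ?rc a = r}"
      using True zip[of "\<lambda>a. ?rc a = r"] by (simp add: comp_def)
    also have "\<dots> = {a \<in> set as. better (?rc a) 0 \<and> (\<forall>b\<in>set as. \<not> better (?rc b) (?rc a))}"
      using iff by (intro Collect_cong conj_cong refl)
    finally show ?thesis .
  next
    case False
    then have "\<not> better (?rc a) 0" if "a \<in> set as" for a
      using trans[of "?rc a" r 0] r(2) that by blast
    then show ?thesis using False by auto
  qed
  have rs: "computes (State_Monad.traverse_list (reduced_cost_prog G (map (val \<pi>) [0..<n])) as)
      (map ?rc as) (length as * 3)"
    by (rule computes_traverse) (use reduced_cost_prog as(1) in blast)
  have ties: "computes (State_Monad.traverse_list (\<lambda>q. tick (q = r)) (map ?rc as))
      (map (\<lambda>q. q = r) (map ?rc as)) (length (map ?rc as) * 1)"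
    by (rule computes_traverse) (rule computes_tick)
  have "computes (entering_prog G better as \<pi>) ?E
      (n * (5 * n + 2) + (length as * 3 + (length as + Suc (length (map ?rc as) * 1 + 0))))"
    unfolding entering_prog_def
    by (intro computes_bind[OF value_prog[OF v]] computes_bind[OF rs] computes_bind[OF r(3)]
        computes_tick_bind computes_bind[OF ties] computes_return)
  then show ?thesis unfolding E by (rule computes_mono) (use as(2) in simp)
qed

lemma entering1_prog:
  assumes "valid \<pi>"
  shows "computes (entering1_prog G \<pi>) (entering1 G \<pi>) (n * (5 * n + 2) + 5 * m + 1)"
proof -
  let ?as = "filter (\<lambda>a. loc G a \<in> states1 G) [0..<m]"
  have "set ?as = acts1 G" by (auto simp: acts12)
  moreover have "length ?as \<le> m" by (rule order_trans[OF length_filter_le]) simp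
  moreover have "computes (entering_prog G (<) ?as \<pi>)
    {a \<in> set ?as. reduced_cost G \<pi> a < 0 \<and>
      (\<forall>b\<in>set ?as. \<not> reduced_cost G \<pi> b < reduced_cost G \<pi> a)}
    (n * (5 * n + 2) + 5 * m + 1)"
    by (rule entering_prog[OF assms]) (use calculation(2) in auto)
  ultimately show ?thesis
    unfolding entering1_prog_def entering1_def by (simp only: not_less)
qed

lemma entering2_prog:
  assumes "valid \<pi>"
  shows "computes (entering2_prog G \<pi>) (entering2 G \<pi>) (n * (5 * n + 2) + 5 * m + 1)"
proof -
  let ?as = "filter (\<lambda>a. loc G a \<in> states2 G) [0..<m]"
  have "set ?as = acts2 G" by (auto simp: acts12)
  moreover have "length ?as \<le> m" by (rule order_trans[OF length_filter_le]) simp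
  moreover have "computes (entering_prog G (>) ?as \<pi>)
    {a \<in> set ?as. reduced_cost G \<pi> a > 0 \<and>
      (\<forall>b\<in>set ?as. \<not> reduced_cost G \<pi> b > reduced_cost G \<pi> a)}
    (n * (5 * n + 2) + 5 * m + 1)"
    by (rule entering_prog[OF assms]) (use calculation(2) in auto)
  ultimately show ?thesis
    unfolding entering2_prog_def entering2_def by (simp only: not_less)
qed

lemma same_value_prog:
  assumes "valid \<pi>" "valid \<rho>"
  shows "computes (same_value_prog G \<pi> \<rho>) (val \<pi> = val \<rho>) (2 * (n * (5 * n + 2)) + n)"
proof -
  let ?vs = "map (val \<pi>) [0..<n]" and ?ws = "map (val \<rho>) [0..<n]"
  let ?es = "map (\<lambda>s. ?vs ! s = ?ws ! s) [0..<n]"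
  have es: "computes (State_Monad.traverse_list (\<lambda>s. tick (?vs ! s = ?ws ! s)) [0..<n]) ?es
      (length [0..<n] * 1)"
    by (rule computes_traverse) (rule computes_tick)
  have "computes (same_value_prog G \<pi> \<rho>) (\<forall>e\<in>set ?es. e)
      (n * (5 * n + 2) + (n * (5 * n + 2) + (length [0..<n] * 1 + 0)))"
    unfolding same_value_prog_def
    by (intro computes_bind[OF value_prog[OF assms(1)]] computes_bind[OF value_prog[OF assms(2)]]
        computes_bind[OF es] computes_return)
  moreover have "(\<forall>e\<in>set ?es. e) \<longleftrightarrow> val \<pi> = val \<rho>"
  proof
    assume "\<forall>e\<in>set ?es. e"
    then show "val \<pi> = val \<rho>"
      using value_vec_extensional[OF assms(1)] value_vec_extensional[OF assms(2)]
      by (intro extensionalityI[of _ "{..<n}"]) auto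
  qed auto
  ultimately show ?thesis by simp
qed

abbreviation step_ops :: nat where "step_ops \<equiv> 3 * (n * (5 * n + 2)) + 5 * m + n + 1"

lemma step_prog_Iterate:
  assumes "valid \<pi>"
  shows "computes (ssi_step_prog G (Iterate \<pi>)) {c. \<exists>k. ssi_step G (Iterate \<pi>) k c} step_ops"
proof -
  obtain \<sigma> \<tau> where \<pi>: "\<pi> = (\<sigma>, \<tau>)" by (cases \<pi>)
  let ?S = "if entering1 G (\<sigma>, \<tau>) = {} then {Respond (\<sigma>, \<tau>) (\<sigma>, \<tau>)}
        else (\<lambda>a. Respond (\<sigma>, \<tau>) (\<sigma>(loc G a := a), \<tau>)) ` entering1 G (\<sigma>, \<tau>)"
  have "computes (ssi_step_prog G (Iterate \<pi>)) ?S (n * (5 * n + 2) + 5 * m + 1 + 0)"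
    unfolding \<pi> ssi_step_prog.simps
    by (rule computes_bind[OF entering1_prog[OF assms[unfolded \<pi>]] computes_return])
  moreover have "?S = {c. \<exists>k. ssi_step G (Iterate \<pi>) k c}"
    unfolding \<pi> by (auto intro: ssi_step.intros elim!: ssi_step.cases)
  ultimately show ?thesis by (auto elim: computes_mono)
qed

lemma step_prog_Respond:
  assumes "valid \<pi>" "valid \<rho>"
  shows "computes (ssi_step_prog G (Respond \<pi> \<rho>)) {c. \<exists>k. ssi_step G (Respond \<pi> \<rho>) k c} step_ops"
proof -
  obtain \<sigma> \<tau> where \<rho>: "\<rho> = (\<sigma>, \<tau>)" by (cases \<rho>)
  note E = entering2_prog[OF assms(2)]
  show ?thesis
  proof (cases "entering2 G \<rho> = {}")
    case True
    let ?S = "{if val \<pi> = val \<rho> then Finished \<rho> else Iterate \<rho>}"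
    have "computes (ssi_step_prog G (Respond \<pi> \<rho>)) ?S
        (n * (5 * n + 2) + 5 * m + 1 + (2 * (n * (5 * n + 2)) + n + 0))"
      unfolding \<rho> ssi_step_prog.simps
      by (rule computes_bind[OF E[unfolded \<rho>]], unfold if_P[OF True[unfolded \<rho>]])
        (rule computes_bind[OF same_value_prog[OF assms[unfolded \<rho>]] computes_return])
    moreover have "?S = {c. \<exists>k. ssi_step G (Respond \<pi> \<rho>) k c}"
      using True ssi_step.finish[of G \<rho> \<pi>] ssi_step.continue[of G \<rho> \<pi>]
      by (auto elim!: ssi_step.cases split: if_splits)
    ultimately show ?thesis by (auto elim: computes_mono)
  next
    case False
    let ?S = "(\<lambda>a. Respond \<pi> (\<sigma>, \<tau>(loc G a := a))) ` entering2 G (\<sigma>, \<tau>)"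
    have "computes (ssi_step_prog G (Respond \<pi> \<rho>)) ?S (n * (5 * n + 2) + 5 * m + 1 + 0)"
      unfolding \<rho> ssi_step_prog.simps
      by (rule computes_bind[OF E[unfolded \<rho>]]) (use False in \<open>auto simp: \<rho> computes_return\<close>)
    moreover have "?S = {c. \<exists>k. ssi_step G (Respond \<pi> \<rho>) k c}"
      using False unfolding \<rho> by (auto intro: ssi_step.intros elim!: ssi_step.cases)
    ultimately show ?thesis by (auto elim: computes_mono)
  qed
qed

lemma step_prog:
  assumes "reached \<pi>0 c t p"
  shows "computes (ssi_step_prog G c) {c'. \<exists>k. ssi_step G c k c'} step_ops"
proof (cases c)
  case (Iterate \<pi>)
  then show ?thesis using assms step_prog_Iterate by (auto simp: settled_def)
next
  case (Respond \<pi> \<rho>)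
  then show ?thesis using assms step_prog_Respond by (auto simp: settled_def)
next
  case (Finished \<pi>)
  have "{c'. \<exists>k. ssi_step G (Finished \<pi>) k c'} = {}" by (auto elim: ssi_step.cases)
  then show ?thesis using Finished by (simp add: computes_return)
qed

lemma exec_bounds:
  assumes "settled \<pi>0" "ssi_exec G (Iterate \<pi>0) p q c"
  shows "\<exists>t. reached \<pi>0 c t p \<and> q \<le> t * step_ops"
  using assms(2)
proof induction
  case start
  have "reached \<pi>0 (Iterate \<pi>0) 0 0" using assms(1) by (auto intro: exI[of _ 0])
  then show ?case by blast
next
  case (extend p q c' k c'')
  then obtain t where t: "reached \<pi>0 c' t p" "q \<le> t * step_ops" by blast
  have "ops (ssi_step_prog G c') \<le> step_ops" using step_prog[OF t(1)] by (rule computes_ops)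
  then have "q + ops (ssi_step_prog G c') \<le> Suc t * step_ops" using t(2) by simp
  then show ?case using reached_step[OF t(1) extend(2)] by blast
qed

end

section \<open>The bounds as functions of the numbers of states and actions\<close>

text \<open>The functions that qualify as bounds in \<^const>\<open>ssi_strongly_polynomial\<close>, in a form that is visibly
  closed under sums and products.\<close>
definition poly2 :: "(nat \<Rightarrow> nat \<Rightarrow> nat) \<Rightarrow> bool" where
  "poly2 F \<longleftrightarrow> (\<exists>b :: nat poly poly. \<forall>n m. F n m = poly (poly b [:m:]) n)"

lemma poly2_const: "poly2 (\<lambda>n m. k)"
  unfolding poly2_def by (rule exI[of _ "[:[:k:]:]"]) simp

lemma poly2_n: "poly2 (\<lambda>n m. n)"
  unfolding poly2_def by (rule exI[of _ "[:[:0, 1:]:]"]) simp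

lemma poly2_m: "poly2 (\<lambda>n m. m)"
  unfolding poly2_def by (rule exI[of _ "[:0, 1:]"]) simp

lemma poly2_add: "poly2 F \<Longrightarrow> poly2 H \<Longrightarrow> poly2 (\<lambda>n m. F n m + H n m)"
  unfolding poly2_def by (elim exE, rule_tac x = "b + ba" in exI) simp

lemma poly2_mult: "poly2 F \<Longrightarrow> poly2 H \<Longrightarrow> poly2 (\<lambda>n m. F n m * H n m)"
  unfolding poly2_def by (elim exE, rule_tac x = "b * ba" in exI) simp

text \<open>The bound of \<open>run_length\<close> with \<open>ln n\<close> replaced by \<open>n\<close>.\<close>
definition run_poly :: "nat \<Rightarrow> nat \<Rightarrow> nat" where
  "run_poly n m = (2 * (n * n) + 1) * (2 * m + 1) * ((2 * (n * n * n) + 1) * (m + n + 1))"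

definition ops_poly :: "nat \<Rightarrow> nat \<Rightarrow> nat" where
  "ops_poly n m = (run_poly n m * (run_poly n m + 2) + 1) * (3 * (n * (5 * n + 2)) + 5 * m + n + 1)"

lemma poly2_ops_poly: "poly2 ops_poly"
proof -
  have "poly2 (\<lambda>n m. ops_poly n m)"
    unfolding ops_poly_def run_poly_def
    by (intro poly2_add poly2_mult poly2_const poly2_n poly2_m)
  then show ?thesis by simp
qed

context tbdfg
begin

lemma N_le_poly: "N \<le> run_poly n m"
proof -
  have ln: "ln (real n) \<le> real n"
    by (cases "n = 0") (use ln_le_minus_one[of "real n"] in auto)
  have "2 * (real n)\<^sup>2 * ln (real n) \<le> 2 * (real n)\<^sup>2 * real n"
    using ln by (intro mult_left_mono) auto
  also have "\<dots> = real (2 * (n * n * n))" by (simp add: power2_eq_square)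
  finally have p: "one.path_block \<le> 2 * (n * n * n) + 1"
    unfolding one.path_block_def by linarith
  have "2 * real n * ln (real n) \<le> 2 * real n * real n"
    using ln by (intro mult_left_mono) auto
  also have "\<dots> = real (2 * (n * n))" by simp
  finally have c: "one.cycle_block \<le> 2 * (n * n) + 1"
    unfolding one.cycle_block_def by linarith
  show ?thesis
    unfolding one.max_run_def run_poly_def using p c by (intro mult_le_mono order_refl)
qed

text \<open>Here \<open>n \<ge> 2\<close> is essential: it bounds \<open>n ln n\<close> from below by 1, so that the rounding in the block lengths
  costs at most a factor 2, and \<open>n \<le> m\<close> turns the counts of tokens into multiples of \<open>m\<close>.\<close>
lemma N_le_asymptotic:
  assumes n2: "2 \<le> n"
  shows "real N \<le> 144 * (real n ^ 3 * real m ^ 2 * ln (real n) ^ 2)"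
proof -
  let ?l = "ln (real n)"
  have "ln (1 / 2 :: real) \<le> 1 / 2 - 1" by (rule ln_le_minus_one) simp
  then have "1 / 2 \<le> ln (2 :: real)" by (simp add: ln_div)
  also have "\<dots> \<le> ?l" using n2 by simp
  finally have l: "1 / 2 \<le> ?l" .
  have nl: "1 \<le> real n * ?l" using mult_mono[of 2 "real n" "1 / 2" ?l] n2 l by simp
  have "1 \<le> real n * (real n * ?l)" using mult_mono[of 1 "real n" 1 "real n * ?l"] n2 nl by simp
  then have nnl: "1 \<le> (real n)\<^sup>2 * ?l" by (simp add: power2_eq_square mult.assoc)
  have p: "real one.path_block \<le> 4 * ((real n)\<^sup>2 * ?l)"
    using nnl unfolding one.path_block_def by (simp add: of_nat_nat) linarith
  have c: "real one.cycle_block \<le> 4 * (real n * ?l)"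
    using nl unfolding one.cycle_block_def by (simp add: of_nat_nat) linarith
  have m: "real (2 * m + 1) \<le> 3 * real m" "real (m + n + 1) \<le> 3 * real m"
    using states_le_actions n2 by auto
  have "real N = real one.cycle_block * real (2 * m + 1) * (real one.path_block * real (m + n + 1))"
    unfolding one.max_run_def by (simp only: of_nat_mult)
  also have "\<dots> \<le> (4 * (real n * ?l)) * (3 * real m) * ((4 * ((real n)\<^sup>2 * ?l)) * (3 * real m))"
    using p c m l by (intro mult_mono mult_nonneg_nonneg) auto
  also have "\<dots> = 144 * (real n ^ 3 * real m ^ 2 * ?l ^ 2)"
    by (simp add: power2_eq_square power3_eq_cube)
  finally show ?thesis .
qed

end

lemma initial_settled:
  assumes "TBDFG G" "initial G c"
  obtains \<pi> where "c = Iterate \<pi>" "tbdfg.settled G \<pi>"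
proof -
  interpret tbdfg G using assms(1) by unfold_locales
  show ?thesis using that assms(2) best_response_settled unfolding initial_def by blast
qed

theorem theorem1:
  shows "(\<forall>G c. TBDFG G \<and> initial G c \<longrightarrow> ssi_converges G c) \<and>
    (\<exists>K::real. \<forall>G c p q c'.
       TBDFG G \<and> nstates G \<ge> 2 \<and> initial G c \<and> ssi_exec G c p q c' \<longrightarrow>
       real p \<le> K * (real (nstates G) ^ 6 * real (nactions G) ^ 4 * ln (real (nstates G)) ^ 4)) \<and>
    ssi_strongly_polynomial TBDFG"
proof (intro conjI)
  show "\<forall>G c. TBDFG G \<and> initial G c \<longrightarrow> ssi_converges G c"
  proof (intro allI impI, elim conjE)
    fix G c assume G: "TBDFG G" and c: "initial G c"
    interpret tbdfg G using G by unfold_locales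
    obtain \<pi> where "c = Iterate \<pi>" "settled \<pi>" using G c by (rule initial_settled)
    then show "ssi_converges G c" using converges by simp
  qed
next
  have "real p \<le> (2 * 144\<^sup>2) * (real (nstates G) ^ 6 * real (nactions G) ^ 4 * ln (real (nstates G)) ^ 4)"
    if G: "TBDFG G" and n: "2 \<le> nstates G" and c: "initial G c" and ex: "ssi_exec G c p q c'"
    for G c p q c'
  proof -
    interpret tbdfg G using G by unfold_locales
    obtain \<pi> where \<pi>: "c = Iterate \<pi>" "settled \<pi>" using G c by (rule initial_settled)
    obtain t where "reached \<pi> c' t p" using exec_bounds[OF \<pi>(2)] ex \<pi>(1) by blast
    then have "p \<le> N * (N + 1)" by (rule reached_bounds)
    \<comment> \<open>The block lengths are positive, hence so is \<open>N\<close>.\<close>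
    also have "\<dots> \<le> 2 * (N * N)"
      unfolding one.max_run_def one.cycle_block_def one.path_block_def by (cases N) auto
    finally have "real p \<le> 2 * (real N)\<^sup>2" by (simp add: power2_eq_square flip: of_nat_mult)
    also have "\<dots> \<le> 2 * (144 * (real n ^ 3 * real m ^ 2 * ln (real n) ^ 2))\<^sup>2"
      using N_le_asymptotic[OF n] by (intro mult_left_mono power_mono) auto
    also have "\<dots> = (2 * 144\<^sup>2) * (real n ^ 6 * real m ^ 4 * ln (real n) ^ 4)"
      by (simp add: power_mult_distrib flip: power_mult)
    finally show ?thesis .
  qed
  then show "\<exists>K::real. \<forall>G c p q c'.
       TBDFG G \<and> nstates G \<ge> 2 \<and> initial G c \<and> ssi_exec G c p q c' \<longrightarrow>
       real p \<le> K * (real (nstates G) ^ 6 * real (nactions G) ^ 4 * ln (real (nstates G)) ^ 4)"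
    by blast
next
  obtain b :: "nat poly poly" where b: "\<And>n m. ops_poly n m = poly (poly b [:m:]) n"
    using poly2_ops_poly unfolding poly2_def by blast
  have "result (ssi_step_prog G c') = {c''. \<exists>k. ssi_step G c' k c''} \<and>
      q \<le> poly (poly b [:nactions G:]) (nstates G)"
    if G: "TBDFG G" and c: "initial G c" and ex: "ssi_exec G c p q c'" for G c p q c'
  proof -
    interpret tbdfg G using G by unfold_locales
    obtain \<pi> where \<pi>: "c = Iterate \<pi>" "settled \<pi>" using G c by (rule initial_settled)
    obtain t where t: "reached \<pi> c' t p" "q \<le> t * step_ops" using exec_bounds[OF \<pi>(2)] ex \<pi>(1) by blast
    have "t \<le> N * (N + 2) + 1" using t(1) by (rule reached_bounds)
    also have "\<dots> \<le> run_poly n m * (run_poly n m + 2) + 1"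
      using N_le_poly by (intro add_mono mult_le_mono) auto
    finally have "t * step_ops \<le> ops_poly n m" unfolding ops_poly_def by (intro mult_right_mono) auto
    then show ?thesis using computes_result[OF step_prog[OF t(1)]] t(2) b by simp
  qed
  then show "ssi_strongly_polynomial TBDFG" unfolding ssi_strongly_polynomial_def by blast
qed

end
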